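(* Let $K$ be a compact generic Cauchy-Riemann nondegenerate $\mathcal{C}^5$ piecewise-smooth submanifold in $\mathbb{C}^n$. Then $K$ is locally regular.
   Context: A (convex) polyhedron in $\mathbb{R}^N$ is the intersection of a finite number of closed half-spaces. A subset $K$ of a real $N$-dimensional smooth manifold $Y$ is called a nondegenerate $\mathcal{C}^5$ piecewise-smooth submanifold of dimension $m$ if for every $p\in K$ there is a local chart $(W_p,\Psi)$ of $Y$ around $p$ such that $\Psi$ is a $\mathcal{C}^5$-diffeomorphism from $W_p$ to the unit ball of $\mathbb{R}^N$ and $\Psi(K\cap W_p)$ is the intersection with the unit ball of a finite union of convex polyhedra of the same dimension $m$. A point $p\in K$ is regular if the chart can be chosen such that $\Psi(K\cap W_p)$ is the intersection of the unit ball with an $m$-dimensional vector subspace of $\mathbb{R}^N$. Here $\mathbb{C}^n$ is regarded as a real $2n$-dimensional manifold with complex structure $J$ on its tangent spaces. $K\subset\mathbb{C}^n$ is (Cauchy-Riemann) generic if for every $p\in K$ and every sequence of regular points $(p_m)_m\subset K$ converging to $p$, any limit $E$ of the tangent spaces $T_{p_m}K$ satisfies $E+JE=T_p\mathbb{C}^n$. A compact set $K$ is locally regular if for every $z\in K$ there is an open neighborhood $U$ of $z$ in $\mathbb{C}^n$ such that for every increasing sequence $(u_j)_j$ of plurisubharmonic functions on $U$, uniformly bounded from above on $U$, with $u_j\le 0$ on $K\cap U$, one has $(\sup_j u_j)^*\le 0$ on $K\cap U$, where $^*$ denotes upper semicontinuous regularization. *)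

theory Defs
  imports "HOL-Analysis.Analysis"
begin

section \<open>Piecewise-smooth submanifolds\<close>

text \<open>
  Intended for open \<open>S\<close>. Continuity of all directional derivatives is continuity of the
  Frechet derivative, since the domain is finite-dimensional.
\<close>

primrec Ck_on :: "nat \<Rightarrow> 'a::euclidean_space set \<Rightarrow> ('a \<Rightarrow> 'b::euclidean_space) \<Rightarrow> bool" where
  "Ck_on 0 S f \<longleftrightarrow> continuous_on S f"
| "Ck_on (Suc k) S f \<longleftrightarrow>
     (\<forall>x\<in>S. f differentiable (at x)) \<and>
     (\<forall>v. Ck_on k S (\<lambda>x. frechet_derivative f (at x) v))"

definition Ck_diffeomorphism ::
    "nat \<Rightarrow> 'a::euclidean_space set \<Rightarrow> 'b::euclidean_space set \<Rightarrow> ('a \<Rightarrow> 'b) \<Rightarrow> bool" where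
  "Ck_diffeomorphism k W V f \<longleftrightarrow>
     open W \<and> open V \<and> bij_betw f W V \<and> Ck_on k W f \<and> Ck_on k V (inv_into W f)"

text \<open>
  The ambient manifold is a Euclidean space \<open>'a\<close>, which also serves as the model
  \<open>\<real>\<^sup>N\<close>, \<open>N = DIM('a)\<close>, of its charts. Charts around \<open>p\<close> need not send \<open>p\<close> to the origin.
\<close>

definition C5_ball_chart ::
    "'a::euclidean_space \<Rightarrow> 'a set \<Rightarrow> ('a \<Rightarrow> 'a) \<Rightarrow> bool" where
  "C5_ball_chart p W \<Psi> \<longleftrightarrow> p \<in> W \<and> Ck_diffeomorphism 5 W (ball 0 1) \<Psi>"

definition C5_piecewise_smooth_submanifold ::
    "nat \<Rightarrow> 'a::euclidean_space set \<Rightarrow> bool" where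
  "C5_piecewise_smooth_submanifold m K \<longleftrightarrow>
     (\<forall>p\<in>K. \<exists>W \<Psi> \<P>. C5_ball_chart p W \<Psi> \<and> finite \<P> \<and>
        (\<forall>P\<in>\<P>. polyhedron P \<and> aff_dim P = int m) \<and>
        \<Psi> ` (K \<inter> W) = ball 0 1 \<inter> \<Union>\<P>)"

definition regular_point ::
    "nat \<Rightarrow> 'a::euclidean_space set \<Rightarrow> 'a \<Rightarrow> bool" where
  "regular_point m K p \<longleftrightarrow> p \<in> K \<and>
     (\<exists>W \<Psi> S. C5_ball_chart p W \<Psi> \<and> subspace S \<and> dim S = m \<and>
        \<Psi> ` (K \<inter> W) = ball 0 1 \<inter> S)"

text \<open>
  Velocities of \<open>C\<^sup>1\<close> curves in \<open>K\<close> through \<open>p\<close>; used only at regular points.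
\<close>

definition tangent_space :: "'a::euclidean_space set \<Rightarrow> 'a \<Rightarrow> 'a set" where
  "tangent_space K p =
     {v. \<exists>\<gamma> \<epsilon>. \<epsilon> > 0 \<and> \<gamma> C1_differentiable_on {-\<epsilon><..<\<epsilon>} \<and> \<gamma> ` {-\<epsilon><..<\<epsilon>} \<subseteq> K \<and>
        \<gamma> 0 = p \<and> (\<gamma> has_vector_derivative v) (at 0)}"

text \<open>
  The operator-norm distance of the orthogonal projections, which metrizes the Grassmannian;
  on a subspace, \<^const>\<open>closest_point\<close> is the orthogonal projection.
\<close>

definition grassmannian_dist :: "'a::euclidean_space set \<Rightarrow> 'a set \<Rightarrow> real" where
  "grassmannian_dist E F = onorm (\<lambda>x. closest_point E x - closest_point F x)"

text \<open>
  The complex structure \<open>J\<close> is \<open>v \<mapsto> \<i> *s v\<close>. Quantifying over convergent sequences of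
  tangent spaces also covers limits along subsequences.
\<close>

definition CR_generic :: "nat \<Rightarrow> (complex ^ 'n) set \<Rightarrow> bool" where
  "CR_generic m K \<longleftrightarrow>
     (\<forall>p\<in>K. \<forall>q E.
        (\<forall>j::nat. regular_point m K (q j)) \<and> q \<longlonglongrightarrow> p \<and> subspace E \<and> dim E = m \<and>
        (\<lambda>j. grassmannian_dist (tangent_space K (q j)) E) \<longlonglongrightarrow> 0
        \<longrightarrow> {v + \<i> *s w | v w. v \<in> E \<and> w \<in> E} = UNIV)"

section \<open>Plurisubharmonic functions and local regularity\<close>

definition usc_on :: "'a::topological_space set \<Rightarrow> ('a \<Rightarrow> ereal) \<Rightarrow> bool" where
  "usc_on U u \<longleftrightarrow> (\<forall>x\<in>U. \<forall>c > u x. \<forall>\<^sub>F y in at x within U. u y < c)"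

text \<open>
  The mean of \<open>u\<close> over a circle as an extended real, i.e. positive minus negative part. The
  positive part is finite whenever \<open>u\<close> is bounded above on the circle, in particular for
  \<open>u < \<infinity>\<close> upper semicontinuous.
\<close>

definition circle_mean :: "(complex \<Rightarrow> ereal) \<Rightarrow> complex \<Rightarrow> real \<Rightarrow> ereal" where
  "circle_mean u a r =
     ereal (1 / (2 * pi)) *
       (enn2ereal (\<integral>\<^sup>+t\<in>{0..2 * pi}. e2ennreal (max 0 (u (a + of_real r * cis t))) \<partial>lborel) -
        enn2ereal (\<integral>\<^sup>+t\<in>{0..2 * pi}. e2ennreal (max 0 (- u (a + of_real r * cis t))) \<partial>lborel))"

text \<open>
  The value \<open>-\<infinity>\<close> is allowed, also identically on components.
\<close>

definition subharmonic_on :: "complex set \<Rightarrow> (complex \<Rightarrow> ereal) \<Rightarrow> bool" where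
  "subharmonic_on V u \<longleftrightarrow>
     (\<forall>z\<in>V. u z < \<infinity>) \<and> usc_on V u \<and>
     (\<forall>a r. r > 0 \<and> cball a r \<subseteq> V \<longrightarrow> u a \<le> circle_mean u a r)"

definition plurisubharmonic_on :: "(complex ^ 'n) set \<Rightarrow> (complex ^ 'n \<Rightarrow> ereal) \<Rightarrow> bool" where
  "plurisubharmonic_on U u \<longleftrightarrow>
     (\<forall>z\<in>U. u z < \<infinity>) \<and> usc_on U u \<and>
     (\<forall>a b. subharmonic_on {\<zeta>. a + \<zeta> *s b \<in> U} (\<lambda>\<zeta>. u (a + \<zeta> *s b)))"

text \<open>
  The filter \<^term>\<open>nhds z\<close> includes \<open>z\<close> itself. For \<open>z\<close> in an open set the value depends only
  on \<open>u\<close> on that set.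
\<close>

definition usc_regularization :: "('a::topological_space \<Rightarrow> ereal) \<Rightarrow> 'a \<Rightarrow> ereal" where
  "usc_regularization u z = Limsup (nhds z) u"

definition locally_regular :: "(complex ^ 'n) set \<Rightarrow> bool" where
  "locally_regular K \<longleftrightarrow>
     (\<forall>z\<in>K. \<exists>U. open U \<and> z \<in> U \<and>
        (\<forall>u :: nat \<Rightarrow> complex ^ 'n \<Rightarrow> ereal.
           (\<forall>j. plurisubharmonic_on U (u j)) \<and>
           (\<forall>x\<in>U. incseq (\<lambda>j. u j x)) \<and>
           (\<exists>M::real. \<forall>j. \<forall>x\<in>U. u j x \<le> ereal M) \<and>
           (\<forall>j. \<forall>x\<in>K \<inter> U. u j x \<le> 0)
           \<longrightarrow> (\<forall>x\<in>K \<inter> U. usc_regularization (\<lambda>y. SUP j. u j y) x \<le> 0)))"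

end

theory Submission
  imports Defs
begin

text \<open>
  A plurisubharmonic function \<open>u\<close> that is at most \<open>M\<close> near a point \<open>p\<close> of \<open>K\<close> and at most \<open>0\<close> on \<open>K\<close> decays
  geometrically at \<open>p\<close>: there are \<open>q, s < 1\<close>, independent of \<open>u\<close>, with \<open>u \<le> M q ^ k\<close> on a ball about
  \<open>p\<close> of radius proportional to \<open>s ^ k\<close>. The bound passes to suprema of families of such functions
  and to their upper semicontinuous regularization, which is therefore at most \<open>0\<close> at \<open>p\<close>. This
  works in any open set \<open>U\<close> around \<open>p\<close> (\<open>usc_regularization_le_0_generic\<close>).

  The geometric input is a corner of real dimension \<open>n\<close> in \<open>K\<close>. A chart at \<open>p\<close> turns \<open>K\<close> into a union of
  polyhedra of dimension \<open>m\<close>, one of which, \<open>P\<close>, contains the image \<open>y0\<close> of \<open>p\<close>. Points in general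
  position in the relative interior of \<open>P\<close> correspond to regular points of \<open>K\<close>, and at those that tend
  to \<open>y0\<close> the tangent spaces of \<open>K\<close> converge to the image of the direction space of \<open>P\<close>. By genericity
  this limit spans the complex space \<open>\<complex>\<^sup>n\<close>, so edges from \<open>y0\<close> to points of \<open>P\<close> can be chosen whose images
  form a complex basis (\<open>CR_generic_chart_span\<close>). In the coordinates of that basis \<open>K\<close> contains the graph-like
  set of all \<open>x + e x\<close>, where \<open>x\<close> runs through the real vectors in a small simplex with vertex \<open>0\<close>; after
  magnification the Lipschitz constant of \<open>e\<close> is as small as one likes.

  The analytic input avoids analytic discs attached to \<open>K\<close>. Off a nearly flat totally real set \<open>S\<close>, the
  function \<open>sqrt (dist z S)\<close> has, in a suitable complex direction, circle means strictly below its
  central value: that direction is the normal one, in which the distance is almost the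
  absolute value of an imaginary part, and the square root is concave. Adding a multiple of
  \<open>dist\<^sup>2 z k0\<close> gives a barrier that dominates \<open>u\<close> by the maximum principle. Hence \<open>u \<le> M / 2\<close> in a ball
  of fixed size around the interior point \<open>k0\<close> of the corner (\<open>plurisubharmonic_le_near_flat\<close>). A circle
  around a point near the vertex that passes through this ball then improves the bound \<open>M\<close> to \<open>q M\<close>
  near the vertex (\<open>plurisubharmonic_le_corner\<close>), and since the corner looks the same at all small
  scales, the improvement can be iterated (\<open>usc_regularization_le_0_at_corner\<close>).
\<close>

section \<open>Sub-mean value inequalities\<close>

lemma has_integral_trig_polynomial:
  fixes a b c d :: real
  shows "((\<lambda>t. a + b * cos t + c * sin t + d * (sin t)\<^sup>2) has_integral (2 * pi * a + pi * d)) {0..2 * pi}"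
proof -
  let ?F = "\<lambda>t. a * t + b * sin t - c * cos t + d * (t / 2 - sin t * cos t / 2)"
  have "((\<lambda>t. a + b * cos t + c * sin t + d * (sin t)\<^sup>2) has_integral (?F (2 * pi) - ?F 0)) {0..2 * pi}"
  proof (rule fundamental_theorem_of_calculus)
    fix t :: real
    have "1 / 2 - (cos t * cos t - sin t * sin t) / 2 = (sin t)\<^sup>2"
      using sin_cos_squared_add[of t] by (simp add: power2_eq_square field_simps)
    moreover have "((\<lambda>t. t / 2 - sin t * cos t / 2) has_real_derivative 1 / 2 - (cos t * cos t - sin t * sin t) / 2) (at t within {0..2 * pi})"
      by (rule derivative_eq_intros refl | simp)+
    ultimately have *: "((\<lambda>t. t / 2 - sin t * cos t / 2) has_real_derivative (sin t)\<^sup>2) (at t within {0..2 * pi})"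
      by simp
    have "(?F has_real_derivative a + b * cos t + c * sin t + d * (sin t)\<^sup>2) (at t within {0..2 * pi})"
      by (rule derivative_eq_intros * refl | simp)+
    then show "(?F has_vector_derivative a + b * cos t + c * sin t + d * (sin t)\<^sup>2) (at t within {0..2 * pi})"
      by (simp add: has_real_derivative_iff_has_vector_derivative)
  qed simp
  then show ?thesis by (simp add: algebra_simps)
qed

text \<open>
  Both integrals in the definition of the mean are monotone in the integrand, whether or not
  \<open>u\<close> is measurable on the circle, so an integrable majorant is all that is needed.
\<close>

lemma circle_mean_le:
  fixes g :: "real \<Rightarrow> real"
  assumes le: "\<And>t. t \<in> {0..2 * pi} \<Longrightarrow> u (a + of_real r * cis t) \<le> ereal (g t)"
    and g: "set_integrable lborel {0..2 * pi} g"
  shows "circle_mean u a r \<le> ereal ((LINT t:{0..2 * pi}|lborel. g t) / (2 * pi))"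
proof -
  let ?I = "{0..2 * pi}"
  let ?h = "\<lambda>t. indicator ?I t * g t"
  have int: "integrable lborel ?h"
    using g by (simp add: set_integrable_def)
  define P where "P = (\<integral>\<^sup>+t. ennreal (?h t) \<partial>lborel)"
  define N where "N = (\<integral>\<^sup>+t. ennreal (- ?h t) \<partial>lborel)"
  have fin: "P < \<infinity>" "N < \<infinity>"
    using int unfolding real_integrable_def P_def N_def by (auto simp: less_top)
  have val: "(LINT t:?I|lborel. g t) = enn2real P - enn2real N"
    using real_lebesgue_integral_def[OF int] by (simp add: set_lebesgue_integral_def P_def N_def)
  have pos: "(\<integral>\<^sup>+t\<in>?I. e2ennreal (max 0 (u (a + of_real r * cis t))) \<partial>lborel) \<le> P"
    unfolding P_def
  proof (rule nn_integral_mono)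
    fix t :: real
    show "e2ennreal (max 0 (u (a + of_real r * cis t))) * indicator ?I t \<le> ennreal (?h t)"
    proof (cases "t \<in> ?I")
      case True
      have "max 0 (u (a + of_real r * cis t)) \<le> max 0 (ereal (g t))"
        using le[OF True] by (intro max.mono) auto
      then have "e2ennreal (max 0 (u (a + of_real r * cis t))) \<le> e2ennreal (max 0 (ereal (g t)))"
        by (rule e2ennreal_mono)
      also have "\<dots> = ennreal (g t)"
        by (metis e2ennreal_ereal e2ennreal_neg ereal_less_eq(5) max_def linorder_le_cases)
      finally show ?thesis using True by simp
    qed simp
  qed
  have neg: "N \<le> (\<integral>\<^sup>+t\<in>?I. e2ennreal (max 0 (- u (a + of_real r * cis t))) \<partial>lborel)"
    unfolding N_def
  proof (rule nn_integral_mono)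
    fix t :: real
    show "ennreal (- ?h t) \<le> e2ennreal (max 0 (- u (a + of_real r * cis t))) * indicator ?I t"
    proof (cases "t \<in> ?I")
      case True
      have "ereal (- g t) \<le> - u (a + of_real r * cis t)"
        using le[OF True] by (metis ereal_minus_le_minus uminus_ereal.simps(1))
      then have "max 0 (ereal (- g t)) \<le> max 0 (- u (a + of_real r * cis t))"
        by (intro max.mono) auto
      then have "e2ennreal (max 0 (ereal (- g t))) \<le> e2ennreal (max 0 (- u (a + of_real r * cis t)))"
        by (rule e2ennreal_mono)
      moreover have "e2ennreal (max 0 (ereal (- g t))) = ennreal (- g t)"
        by (metis e2ennreal_ereal e2ennreal_neg ereal_less_eq(5) max_def linorder_le_cases)
      ultimately show ?thesis using True by simp
    qed simp
  qed
  have "circle_mean u a r \<le> ereal (1 / (2 * pi)) * (enn2ereal P - enn2ereal N)"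
    unfolding circle_mean_def
    by (intro ereal_mult_left_mono ereal_minus_mono)
       (use pos neg in \<open>auto simp: less_eq_ennreal.rep_eq\<close>)
  also have "enn2ereal P - enn2ereal N = ereal (enn2real P - enn2real N)"
    using fin by (cases P; cases N) (auto simp: enn2ereal_ennreal)
  finally show ?thesis by (simp add: val)
qed

text \<open>All later estimates use plurisubharmonicity in this form: one complex line, one circle.\<close>

lemma plurisubharmonic_on_circle_le:
  assumes psh: "plurisubharmonic_on U u" and r: "r > 0"
    and disc: "\<And>\<zeta>. norm \<zeta> \<le> r \<Longrightarrow> a + \<zeta> *s b \<in> U"
    and le: "\<And>t. t \<in> {0..2 * pi} \<Longrightarrow> u (a + (of_real r * cis t) *s b) \<le> ereal (g t)"
    and g: "set_integrable lborel {0..2 * pi} g"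
  shows "u a \<le> ereal ((LINT t:{0..2 * pi}|lborel. g t) / (2 * pi))"
proof -
  have "subharmonic_on {\<zeta>. a + \<zeta> *s b \<in> U} (\<lambda>\<zeta>. u (a + \<zeta> *s b))"
    using psh by (auto simp: plurisubharmonic_on_def)
  then have "u (a + 0 *s b) \<le> circle_mean (\<lambda>\<zeta>. u (a + \<zeta> *s b)) 0 r"
    unfolding subharmonic_on_def using r disc
    by (metis (no_types, lifting) mem_Collect_eq mem_cball_0 subsetI)
  also have "\<dots> \<le> ereal ((LINT t:{0..2 * pi}|lborel. g t) / (2 * pi))"
    by (rule circle_mean_le) (use le g in auto)
  finally show ?thesis by simp
qed

text \<open>
  Without a maximum, the sets \<open>{y. u y < u z}\<close> with \<open>z \<in> C\<close> cover \<open>C\<close>; the best of the finitely many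
  \<open>z\<close> that suffice would then lie in none of them.
\<close>

lemma usc_on_attains_sup:
  assumes usc: "usc_on U u" and C: "compact C" "C \<noteq> {}" "C \<subseteq> U"
  shows "\<exists>w\<in>C. \<forall>z\<in>C. u z \<le> u w"
proof (rule ccontr)
  assume "\<not> ?thesis"
  then have ex: "\<exists>z\<in>C. u w < u z" if "w \<in> C" for w
    using that by (auto simp: not_le)
  have "\<exists>V. open V \<and> x \<in> V \<and> (\<exists>z\<in>C. \<forall>y\<in>V \<inter> C. u y < u z)" if x: "x \<in> C" for x
  proof -
    obtain z where z: "z \<in> C" "u x < u z" using ex[OF x] by blast
    then have "\<forall>\<^sub>F y in at x within U. u y < u z"
      using usc x C(3) by (auto simp: usc_on_def)
    then obtain V where "open V" "x \<in> V" "\<forall>y\<in>V. y \<noteq> x \<longrightarrow> y \<in> U \<longrightarrow> u y < u z"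
      unfolding eventually_at_topological by blast
    then show ?thesis using z C(3) by (metis Int_iff subsetD)
  qed
  then obtain V Z where V: "\<And>x. x \<in> C \<Longrightarrow> open (V x) \<and> x \<in> V x \<and> Z x \<in> C \<and> (\<forall>y\<in>V x \<inter> C. u y < u (Z x))"
    by metis
  obtain D where D: "D \<subseteq> C" "finite D" "C \<subseteq> (\<Union>x\<in>D. V x)"
    using compactE_image[OF C(1), of C V] V by blast
  have "D \<noteq> {}" using D C(2) by auto
  define m where "m = Max ((\<lambda>x. u (Z x)) ` D)"
  have "m \<in> (\<lambda>x. u (Z x)) ` D" unfolding m_def using D \<open>D \<noteq> {}\<close> by (intro Max_in) auto
  then obtain x where x: "x \<in> D" "u (Z x) = m" by auto
  then obtain y where y: "y \<in> D" "Z x \<in> V y" using D V by blast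
  then have "u (Z x) < u (Z y)" using V x D by blast
  moreover have "u (Z y) \<le> m" unfolding m_def using D y by auto
  ultimately show False using x by simp
qed

lemma usc_on_diff_continuous:
  fixes \<phi> :: "'a::topological_space \<Rightarrow> real"
  assumes usc: "usc_on U u" and cont: "continuous_on UNIV \<phi>"
  shows "usc_on U (\<lambda>z. u z - ereal (\<phi> z))"
  unfolding usc_on_def
proof (intro ballI allI impI)
  fix x c assume x: "x \<in> U" and c: "u x - ereal (\<phi> x) < c"
  have lt: "u x < c + ereal (\<phi> x)"
    using c by (cases "u x"; cases c) auto
  then obtain d where d: "u x < d" "d < c + ereal (\<phi> x)" using dense by blast
  have "(\<phi> \<longlongrightarrow> \<phi> x) (at x within U)"
    using cont by (auto simp: continuous_on_def intro: tendsto_within_subset)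
  moreover have "d - c < ereal (\<phi> x)"
    using d by (cases d; cases c) auto
  ultimately have "\<forall>\<^sub>F y in at x within U. d - c < ereal (\<phi> y)"
    by (intro order_tendstoD) (auto intro: tendsto_ereal)
  moreover have "\<forall>\<^sub>F y in at x within U. u y < d"
    using usc x d by (auto simp: usc_on_def)
  ultimately show "\<forall>\<^sub>F y in at x within U. u y - ereal (\<phi> y) < c"
  proof eventually_elim
    case (elim y)
    then show ?case using d lt by (cases "u y"; cases d; cases c) auto
  qed
qed

text \<open>
  Complex affine maps send complex lines to complex lines, so plurisubharmonicity, although only
  tested on lines, is compatible with linear coordinates adapted to \<open>K\<close> and with dilations.
\<close>

lemma plurisubharmonic_on_affine:
  fixes A :: "complex ^ 'n ^ 'n" and p :: "complex ^ 'n"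
  assumes psh: "plurisubharmonic_on U u"
  shows "plurisubharmonic_on {z. p + A *v z \<in> U} (\<lambda>z. u (p + A *v z))"
  unfolding plurisubharmonic_on_def
proof (intro conjI allI ballI)
  fix z assume "z \<in> {z. p + A *v z \<in> U}"
  then show "u (p + A *v z) < \<infinity>" using psh by (auto simp: plurisubharmonic_on_def)
next
  show "usc_on {z. p + A *v z \<in> U} (\<lambda>z. u (p + A *v z))"
    unfolding usc_on_def
  proof (intro ballI allI impI)
    fix z c assume z: "z \<in> {z. p + A *v z \<in> U}" and c: "u (p + A *v z) < c"
    then have "\<forall>\<^sub>F y in at (p + A *v z) within U. u y < c"
      using psh by (auto simp: plurisubharmonic_on_def usc_on_def)
    then obtain V where V: "open V" "p + A *v z \<in> V" "\<forall>y\<in>V. y \<noteq> p + A *v z \<longrightarrow> y \<in> U \<longrightarrow> u y < c"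
      unfolding eventually_at_topological by blast
    have "continuous_on UNIV (\<lambda>z. p + A *v z)"
      by (intro continuous_intros linear_continuous_on matrix_vector_mul_bounded_linear)
    then have "open ((\<lambda>z. p + A *v z) -` V)"
      using V(1) by (simp add: open_vimage)
    then show "\<forall>\<^sub>F y in at z within {z. p + A *v z \<in> U}. u (p + A *v y) < c"
      unfolding eventually_at_topological using V c
      by (intro exI[of _ "(\<lambda>z. p + A *v z) -` V"]) auto
  qed
next
  fix a b
  have *: "p + A *v (a + \<zeta> *s b) = (p + A *v a) + \<zeta> *s (A *v b)" for \<zeta>
    by (simp add: matrix_vector_right_distrib vector_scalar_commute algebra_simps)
  show "subharmonic_on {\<zeta>. a + \<zeta> *s b \<in> {z. p + A *v z \<in> U}} (\<lambda>\<zeta>. u (p + A *v (a + \<zeta> *s b)))"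
    unfolding * mem_Collect_eq using psh by (auto simp: plurisubharmonic_on_def)
qed

section \<open>Distance to a nearly flat totally real set\<close>

definition cvec :: "real ^ 'n \<Rightarrow> complex ^ 'n" where
  "cvec x = (\<chi> i. complex_of_real (x $ i))"

definition Re_vec :: "complex ^ 'n \<Rightarrow> real ^ 'n" where
  "Re_vec v = (\<chi> i. Re (v $ i))"

definition Im_vec :: "complex ^ 'n \<Rightarrow> real ^ 'n" where
  "Im_vec v = (\<chi> i. Im (v $ i))"

lemma cvec_add: "cvec (x + y) = cvec x + cvec y"
  and cvec_diff: "cvec (x - y) = cvec x - cvec y"
  and cvec_scaleR: "cvec (c *\<^sub>R x) = complex_of_real c *s cvec x"
  and cvec_zero [simp]: "cvec 0 = 0"
  by (simp_all add: cvec_def vec_eq_iff)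

lemma scaleR_eq_of_real: "c *\<^sub>R (v :: complex ^ 'n) = complex_of_real c *s v"
  by (simp add: vec_eq_iff scaleR_conv_of_real[where 'a = complex])

lemma linear_cvec: "linear cvec"
  by (rule linearI) (simp_all add: cvec_add cvec_scaleR scaleR_eq_of_real)

lemma power2_norm_vec: "(norm (v :: 'a::real_normed_vector ^ 'n))\<^sup>2 = (\<Sum>i\<in>UNIV. (norm (v $ i))\<^sup>2)"
  by (simp add: norm_vec_def L2_set_def sum_nonneg)

lemma norm_vector_smult: "norm (\<zeta> *s v) = cmod \<zeta> * norm (v :: complex ^ 'n)"
proof (rule power2_eq_imp_eq)
  show "(norm (\<zeta> *s v))\<^sup>2 = (cmod \<zeta> * norm v)\<^sup>2"
    by (simp add: power2_norm_vec norm_mult power_mult_distrib sum_distrib_left)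
qed simp_all

lemma norm_cvec [simp]: "norm (cvec x) = norm x"
  by (rule power2_eq_imp_eq) (simp_all add: power2_norm_vec cvec_def)

lemma cvec_Re_Im: "cvec (Re_vec v) + \<i> *s cvec (Im_vec v) = v"
  by (simp add: cvec_def Re_vec_def Im_vec_def vec_eq_iff complex_eq[symmetric])

lemma power2_norm_Re_Im: "(norm v)\<^sup>2 = (norm (Re_vec v))\<^sup>2 + (norm (Im_vec v))\<^sup>2"
  by (simp add: power2_norm_vec Re_vec_def Im_vec_def sum.distrib[symmetric] cmod_power2)

text \<open>
  On a circle in a complex line the squared distance to a point is a trigonometric polynomial
  whose mean exceeds its central value by exactly \<open>r\<^sup>2 (norm b)\<^sup>2\<close>.
\<close>

lemma power2_norm_add_smult_cis:
  fixes a b :: "complex ^ 'n"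
  shows "(norm (a + (of_real r * cis t) *s b))\<^sup>2 =
    (norm a)\<^sup>2 + 2 * r * inner a b * cos t + 2 * r * inner a (\<i> *s b) * sin t + r\<^sup>2 * (norm b)\<^sup>2"
proof -
  let ?c = "(of_real r * cis t) *s b"
  have "?c = (r * cos t) *\<^sub>R b + (r * sin t) *\<^sub>R (\<i> *s b)"
    by (simp add: vec_eq_iff cis.code scaleR_conv_of_real[where 'a = complex] Complex_eq algebra_simps)
  then have "inner a ?c = r * cos t * inner a b + r * sin t * inner a (\<i> *s b)"
    by (simp add: inner_add_right)
  moreover have "(norm (a + ?c))\<^sup>2 = (norm a)\<^sup>2 + 2 * inner a ?c + (norm ?c)\<^sup>2"
    by (simp add: power2_norm_eq_inner inner_add_left inner_add_right inner_commute)
  moreover have "(norm ?c)\<^sup>2 = r\<^sup>2 * (norm b)\<^sup>2"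
    by (simp add: norm_vector_smult norm_mult power_mult_distrib)
  ultimately show ?thesis by (simp add: algebra_simps)
qed

text \<open>
  Strict concavity of the square root in quantitative form: the term \<open>- (s - 1)\<^sup>2 / 16\<close> is what
  pushes the circle means of the barrier below its central value. Writing \<open>q = sqrt s\<close>, the
  difference of the two sides is \<open>(q - 1)\<^sup>2 (1 / 2 - (q + 1)\<^sup>2 / 16)\<close>.
\<close>

lemma sqrt_le_quadratic:
  assumes "0 \<le> s" "s \<le> 3"
  shows "sqrt s \<le> 1 + (s - 1) / 2 - (s - 1)\<^sup>2 / 16"
proof -
  define q where "q = sqrt s"
  have q: "0 \<le> q" "s = q\<^sup>2" using assms by (auto simp: q_def)
  have "q\<^sup>2 \<le> (9 / 5)\<^sup>2" using assms q by (simp add: power2_eq_square)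
  then have "q \<le> 9 / 5" by (rule power2_le_imp_le) simp
  then have "(q + 1)\<^sup>2 \<le> (14 / 5)\<^sup>2" using q by (intro power_mono) auto
  then have "0 \<le> (q - 1)\<^sup>2 * (1 / 2 - (q + 1)\<^sup>2 / 16)"
    by (intro mult_nonneg_nonneg) (auto simp: power2_eq_square)
  also have "\<dots> = 1 + (q\<^sup>2 - 1) / 2 - (q\<^sup>2 - 1)\<^sup>2 / 16 - q"
    by (simp add: power2_eq_square field_simps)
  finally have "q \<le> 1 + (q\<^sup>2 - 1) / 2 - (q\<^sup>2 - 1)\<^sup>2 / 16" by simp
  then show ?thesis unfolding q(2)[symmetric] by (simp only: q_def)
qed

text \<open>
  Let \<open>k\<close> be a point of \<open>S\<close> nearest to \<open>w\<close>. As \<open>S\<close> is nearly parallel to the real directions, \<open>w - k\<close>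
  is nearly purely imaginary; let \<open>b\<close> be the real unit vector with \<open>w - k\<close> close to \<open>\<i> t b\<close>. When
  \<open>w\<close> moves along the complex line spanned by \<open>b\<close>, the real part of the displacement can be
  followed by moving \<open>k\<close> inside \<open>S\<close>, so only the imaginary part changes the distance. Up to errors of
  order \<open>\<delta> t\<close>, the distance on the circle of radius \<open>t / 2\<close> is thus at most the affine function
  \<open>t + (t / 2) sin \<theta>\<close>. The radius 4 of the parameter ball leaves room for these moves of \<open>k\<close>.
\<close>

lemma infdist_near_flat:
  fixes e :: "real ^ 'n \<Rightarrow> complex ^ 'n"
  assumes lip: "\<delta>-lipschitz_on (cball x0 4) e" and \<delta>: "\<delta> \<le> 1 / 400"
    and S: "S = (\<lambda>x. cvec x + e x) ` cball x0 4" and k0: "k0 = cvec x0 + e x0"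
    and w: "dist w k0 \<le> 1" "w \<notin> S" and t_def: "t = infdist w S"
  obtains b :: "real ^ 'n" where "0 < t" "norm b = 1"
    "\<And>\<theta>. infdist (w + (of_real (t / 2) * cis \<theta>) *s cvec b) S \<le> t * (1 + 3 * \<delta> + sin \<theta> / 2)"
proof -
  have \<delta>0: "0 \<le> \<delta>" using lip by (rule lipschitz_on_nonneg)
  have lipe: "norm (e x - e y) \<le> \<delta> * norm (x - y)" if "norm (x - x0) \<le> 4" "norm (y - x0) \<le> 4" for x y
    using lipschitz_onD[OF lip, of x y] that by (simp add: dist_norm norm_minus_commute)
  have k0S: "k0 \<in> S" unfolding S k0 by auto
  have "continuous_on (cball x0 4) (\<lambda>x. cvec x + e x)"
    by (intro continuous_intros lipschitz_on_continuous_on[OF lip] linear_continuous_on linear_cvec[THEN linear_conv_bounded_linear[THEN iffD1]])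
  then have "compact S" unfolding S by (rule compact_continuous_image) simp
  then have cl: "closed S" by (rule compact_imp_closed)
  have t0: "0 < t"
    using in_closed_iff_infdist_zero[OF cl, of w] w k0S infdist_nonneg[of w S] unfolding t_def
    by (metis empty_iff less_eq_real_def)
  have t1: "t \<le> 1" using infdist_le[OF k0S, of w] w by (simp add: t_def)
  obtain k where k: "k \<in> S" "t = dist w k"
    using infdist_attains_inf[OF cl, of w] k0S unfolding t_def by blast
  then obtain x where x': "x \<in> cball x0 4" and xk: "k = cvec x + e x"
    unfolding S by blast
  then have x: "norm (x - x0) \<le> 4" "k = cvec x + e x"
    by (auto simp: dist_norm norm_minus_commute)
  have tnorm: "t = norm (w - k)" using k by (simp add: dist_norm)
  have xx0: "norm (x - x0) \<le> 3"
  proof -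
    have "norm (k - k0) \<le> 2"
      using dist_triangle[of k k0 w] k w t1 by (simp add: dist_norm norm_minus_commute)
    moreover have "norm (x - x0) = norm ((k - k0) - (e x - e x0))"
      unfolding x k0 by (metis (no_types, opaque_lifting) add_diff_add add_diff_cancel_right' cvec_diff norm_cvec)
    moreover have "norm (e x - e x0) \<le> \<delta> * norm (x - x0)" by (rule lipe) (use x in auto)
    moreover have "\<delta> * norm (x - x0) \<le> 1 / 400 * 4" using \<delta> \<delta>0 x by (intro mult_mono) auto
    ultimately show ?thesis using norm_triangle_ineq4[of "k - k0" "e x - e x0"] by linarith
  qed
  define v where "v = w - k"
  define a where "a = Re_vec v"
  define y where "y = Im_vec v"
  have v: "v = cvec a + \<i> *s cvec y" by (simp add: a_def y_def cvec_Re_Im)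
  have sq: "t\<^sup>2 = (norm a)\<^sup>2 + (norm y)\<^sup>2"
    using power2_norm_Re_Im[of v] by (simp add: tnorm v_def a_def y_def)
  have at: "norm a \<le> t" by (rule power2_le_imp_le) (use sq t0 in auto)
  have yt: "norm y \<le> t" by (rule power2_le_imp_le) (use sq t0 in auto)
  have dle: "t \<le> norm (w - (cvec x' + e x'))" if "norm (x' - x0) \<le> 4" for x'
    using infdist_le[of "cvec x' + e x'" S w] that
    by (auto simp: S t_def dist_norm norm_minus_commute)
  have small: "norm (x + z - x0) \<le> 4" if "norm z \<le> 1" for z
    using norm_triangle_ineq[of "x - x0" z] that xx0 by (simp add: algebra_simps)
  \<comment> \<open>Moving the foot point \<open>x\<close> by the real part of \<open>w - k\<close> cannot bring \<open>S\<close> closer to \<open>w\<close>.\<close>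
  have ty: "t \<le> norm y + \<delta> * norm a"
  proof -
    have 4: "norm (x + a - x0) \<le> 4" using at t1 by (intro small) auto
    have "w - (cvec (x + a) + e (x + a)) = \<i> *s cvec y - (e (x + a) - e x)"
      using v unfolding v_def x(2) by (simp add: cvec_add algebra_simps)
    with dle[OF 4] have "t \<le> norm (\<i> *s cvec y - (e (x + a) - e x))" by metis
    also have "\<dots> \<le> norm (\<i> *s cvec y) + norm (e (x + a) - e x)" by (rule norm_triangle_ineq4)
    also have "norm (e (x + a) - e x) \<le> \<delta> * norm (x + a - x)" by (rule lipe[OF 4 x(1)])
    finally show ?thesis by (simp add: norm_vector_smult)
  qed
  have a2: "norm a \<le> 2 * \<delta> * t"
  proof -
    have "(norm a)\<^sup>2 = (t - norm y) * (t + norm y)"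
      using sq by (simp add: power2_eq_square algebra_simps)
    also have "\<dots> \<le> (\<delta> * norm a) * (2 * t)" using ty yt t0 \<delta>0 by (intro mult_mono) auto
    finally have "norm a * norm a \<le> norm a * (2 * \<delta> * t)"
      by (simp add: power2_eq_square algebra_simps)
    then show ?thesis using \<delta>0 t0 by (cases "norm a = 0") auto
  qed
  have "\<delta> * norm a \<le> 1 / 400 * t" using \<delta> \<delta>0 at by (intro mult_mono) auto
  then have y2: "t / 2 \<le> norm y" using ty t0 by linarith
  define b where "b = y /\<^sub>R norm y"
  have y0: "norm y > 0" using y2 t0 by linarith
  have b1: "norm b = 1" using y0 by (simp add: b_def)
  have yb: "y = norm y *\<^sub>R b" using y0 by (simp add: b_def)
  show thesis
  proof
    show "0 < t" "norm b = 1" by fact+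
    fix \<theta>
    let ?z = "w + (of_real (t / 2) * cis \<theta>) *s cvec b"
    define c where "c = (t / 2 * cos \<theta>) *\<^sub>R b"
    have nc: "norm c \<le> t / 2" using b1 t0 by (simp add: c_def abs_mult)
    have 4: "norm (x + c - x0) \<le> 4" using nc t1 by (intro small) auto
    have e: "norm (e (x + c) - e x) \<le> \<delta> * (t / 2)"
    proof -
      have "norm (e (x + c) - e x) \<le> \<delta> * norm (x + c - x)" by (rule lipe[OF 4 x(1)])
      also have "\<dots> \<le> \<delta> * (t / 2)" using nc \<delta>0 by (intro mult_left_mono) auto
      finally show ?thesis .
    qed
    have "cvec (x + c) + e (x + c) \<in> S"
      using 4 unfolding S by (auto simp: dist_norm norm_minus_commute)
    then have "infdist ?z S \<le> norm (?z - (cvec (x + c) + e (x + c)))"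
      using infdist_le by (metis dist_norm)
    also have "?z - (cvec (x + c) + e (x + c)) =
        cvec a + (\<i> * of_real (norm y + t / 2 * sin \<theta>)) *s cvec b - (e (x + c) - e x)"
    proof -
      have "w = cvec a + \<i> *s cvec y + (cvec x + e x)"
        using v unfolding v_def x(2) by (simp add: algebra_simps)
      also have "\<i> *s cvec y = (\<i> * of_real (norm y)) *s cvec b"
        by (subst yb) (simp add: cvec_scaleR)
      finally have w': "w = cvec a + (\<i> * of_real (norm y)) *s cvec b + (cvec x + e x)" .
      have c': "cvec (x + c) = cvec x + of_real (t / 2 * cos \<theta>) *s cvec b"
        by (simp add: cvec_add c_def cvec_scaleR)
      show ?thesis unfolding c' by (subst w') (simp add: vec_eq_iff cis.code Complex_eq algebra_simps)
    qed
    also have "norm \<dots> \<le> norm (cvec a) + norm ((\<i> * of_real (norm y + t / 2 * sin \<theta>)) *s cvec b) + norm (e (x + c) - e x)"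
      by (meson norm_triangle_ineq norm_triangle_ineq4 add_mono order_refl order_trans)
    also have "norm ((\<i> * of_real (norm y + t / 2 * sin \<theta>)) *s cvec b) = \<bar>norm y + t / 2 * sin \<theta>\<bar>"
      unfolding norm_vector_smult norm_cvec b1 norm_mult norm_of_real by simp
    also have "\<bar>norm y + t / 2 * sin \<theta>\<bar> = norm y + t / 2 * sin \<theta>"
    proof -
      have "t / 2 * (-1) \<le> t / 2 * sin \<theta>" using t0 by (intro mult_left_mono) auto
      then show ?thesis using y2 by linarith
    qed
    finally have "infdist ?z S \<le> norm a + (norm y + t / 2 * sin \<theta>) + norm (e (x + c) - e x)" by simp
    moreover have "\<delta> * (t / 2) \<le> \<delta> * t" using \<delta>0 t0 by (intro mult_left_mono) auto
    ultimately show "infdist ?z S \<le> t * (1 + 3 * \<delta> + sin \<theta> / 2)"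
      using a2 yt e by (simp add: algebra_simps)
  qed
qed

text \<open>
  The right-hand side dominates the barrier \<open>\<Phi> z = M (100 sqrt (infdist z S) + dist\<^sup>2 z k0)\<close>, which is
  nonnegative on \<open>S\<close> and at least \<open>M\<close> outside the unit ball about \<open>k0\<close>. If \<open>u - \<Phi>\<close> had a positive
  maximum at \<open>w\<close>, then \<open>w \<notin> S\<close>, and the sub-mean value inequality on the circle of radius
  \<open>t / 2 = infdist w S / 2\<close> in the direction \<open>b\<close> of the preceding lemma would bound \<open>\<Phi> w\<close> by its
  circle mean. But there the square root loses at least \<open>(1 / 128 - 3 \<delta> / 2) sqrt t\<close> by strict
  concavity, while the squared distance gains only \<open>t\<^sup>2 / 4 \<le> sqrt t / 4\<close>. With \<open>\<delta> \<le> 1 / 400\<close> the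
  factor 100 makes the loss prevail.
\<close>

lemma plurisubharmonic_le_near_flat:
  fixes e :: "real ^ 'n \<Rightarrow> complex ^ 'n"
  assumes psh: "plurisubharmonic_on U u" and U: "cball k0 2 \<subseteq> U"
    and lip: "\<delta>-lipschitz_on (cball x0 4) e" and \<delta>: "\<delta> \<le> 1 / 400"
    and k0: "k0 = cvec x0 + e x0"
    and M: "M > 0" "\<And>z. z \<in> cball k0 2 \<Longrightarrow> u z \<le> ereal M"
    and S0: "\<And>x. x \<in> cball x0 4 \<Longrightarrow> cvec x + e x \<in> cball k0 2 \<Longrightarrow> u (cvec x + e x) \<le> 0"
    and z: "z \<in> cball k0 1"
  shows "u z \<le> ereal (M * (100 * sqrt (dist z k0) + (dist z k0)\<^sup>2))"
proof -
  define S where "S = (\<lambda>x. cvec x + e x) ` cball x0 4"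
  have k0S: "k0 \<in> S" unfolding S_def k0 by auto
  define \<Phi> where "\<Phi> z = M * (100 * sqrt (infdist z S) + (norm (z - k0))\<^sup>2)" for z
  have \<Phi>0: "0 \<le> \<Phi> z" for z using M by (auto simp: \<Phi>_def intro!: mult_nonneg_nonneg add_nonneg_nonneg infdist_nonneg)
  have cont: "continuous_on UNIV \<Phi>"
    unfolding \<Phi>_def by (intro continuous_intros)
  have "usc_on U u" using psh by (simp add: plurisubharmonic_on_def)
  then have "usc_on U (\<lambda>z. u z - ereal (\<Phi> z))" using cont by (rule usc_on_diff_continuous)
  moreover have "cball k0 1 \<subseteq> U" using U subset_cball[of 1 2 k0] by auto
  ultimately obtain w where w: "w \<in> cball k0 1"
      and wmax: "\<And>z. z \<in> cball k0 1 \<Longrightarrow> u z - ereal (\<Phi> z) \<le> u w - ereal (\<Phi> w)"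
    using usc_on_attains_sup[of U "\<lambda>z. u z - ereal (\<Phi> z)" "cball k0 1"] by fastforce
  have "u w \<le> ereal (\<Phi> w)"
  proof (rule ccontr)
    assume "\<not> u w \<le> ereal (\<Phi> w)"
    then have pos: "ereal (\<Phi> w) < u w" by simp
    moreover have "u w \<le> ereal M" using w subset_cball[of 1 2 k0] by (intro M) auto
    ultimately obtain uw where uw: "u w = ereal uw" by (cases "u w") auto
    have wS: "w \<notin> S"
    proof
      assume "w \<in> S"
      then have "u w \<le> 0" using S0 w subset_cball[of 1 2 k0] unfolding S_def by auto
      then show False using pos \<Phi>0[of w] by (metis ereal_less_eq(5) order.strict_trans2 order.asym less_le_trans leD)
    qed
    have wd: "dist w k0 \<le> 1" using w by (simp add: dist_commute)
    define t where "t = infdist w S"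
    obtain b where t0: "0 < t" and b: "norm b = 1"
      and db: "\<And>\<theta>. infdist (w + (of_real (t / 2) * cis \<theta>) *s cvec b) S \<le> t * (1 + 3 * \<delta> + sin \<theta> / 2)"
      using infdist_near_flat[OF lip \<delta> S_def k0 wd wS t_def] by blast
    have \<delta>0: "0 \<le> \<delta>" using lip by (rule lipschitz_on_nonneg)
    have t1: "t \<le> 1" using infdist_le[OF k0S, of w] wd by (simp add: t_def)
    have ball2: "w + \<zeta> *s cvec b \<in> cball k0 2" if "norm \<zeta> \<le> t / 2" for \<zeta>
      using norm_triangle_ineq[of "w - k0" "\<zeta> *s cvec b"] that t1 wd b
      by (simp add: dist_norm norm_vector_smult norm_minus_commute algebra_simps)
    define D where "D = uw - \<Phi> w"
    have D0: "D > 0" using pos uw by (simp add: D_def)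
    \<comment> \<open>Off the closed unit ball the barrier is at least \<open>M\<close>, so the comparison holds on the whole circle.\<close>
    have uD: "u z \<le> ereal (\<Phi> z + D)" if z: "z \<in> cball k0 2" for z
    proof (cases "z \<in> cball k0 1")
      case True
      have "u z - ereal (\<Phi> z) \<le> ereal D" using wmax[OF True] uw by (simp add: D_def)
      then show ?thesis by (cases "u z") auto
    next
      case False
      then have "1 \<le> (norm (z - k0))\<^sup>2" by (simp add: dist_norm norm_minus_commute)
      then have "M * 1 \<le> \<Phi> z" unfolding \<Phi>_def using M infdist_nonneg[of z S] by (intro mult_left_mono add_increasing) auto
      then have "ereal M \<le> ereal (\<Phi> z + D)" using D0 by simp
      then show ?thesis using M(2)[OF z] by (rule order_trans[rotated])
    qed
    define A where "A = inner (w - k0) (cvec b)"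
    define B where "B = inner (w - k0) (\<i> *s cvec b)"
    define g where "g \<theta> = (M * (100 * sqrt t * (1 + 3 * \<delta> / 2 - 9 * \<delta>\<^sup>2 / 16) + (norm (w - k0))\<^sup>2 + t\<^sup>2 / 4) + D)
       + M * t * A * cos \<theta> + (M * (100 * sqrt t * (1 / 4 - 3 * \<delta> / 16) + t * B)) * sin \<theta>
       + (- (M * 100 * sqrt t / 64)) * (sin \<theta>)\<^sup>2" for \<theta>
    have gle: "u (w + (of_real (t / 2) * cis \<theta>) *s cvec b) \<le> ereal (g \<theta>)" for \<theta>
    proof -
      let ?z = "w + (of_real (t / 2) * cis \<theta>) *s cvec b"
      let ?s = "1 + 3 * \<delta> + sin \<theta> / 2"
      have s: "0 \<le> ?s" "?s \<le> 3" using \<delta> \<delta>0 sin_le_one[of \<theta>] sin_ge_minus_one[of \<theta>] by linarith+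
      have "sqrt (infdist ?z S) \<le> sqrt (t * ?s)" using db by (rule real_sqrt_le_mono)
      also have "\<dots> = sqrt t * sqrt ?s" by (rule real_sqrt_mult)
      also have "\<dots> \<le> sqrt t * (1 + (?s - 1) / 2 - (?s - 1)\<^sup>2 / 16)"
        using sqrt_le_quadratic[OF s] t0 by (intro mult_left_mono) auto
      finally have 1: "sqrt (infdist ?z S) \<le> sqrt t * (1 + (?s - 1) / 2 - (?s - 1)\<^sup>2 / 16)" .
      have 2: "(norm (?z - k0))\<^sup>2 = (norm (w - k0))\<^sup>2 + t * A * cos \<theta> + t * B * sin \<theta> + t\<^sup>2 / 4"
        using power2_norm_add_smult_cis[of "w - k0" "t / 2" \<theta> "cvec b"] b
        by (simp add: A_def B_def algebra_simps power_divide)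
      have "\<Phi> ?z \<le> M * (100 * (sqrt t * (1 + (?s - 1) / 2 - (?s - 1)\<^sup>2 / 16)) + (norm (?z - k0))\<^sup>2)"
        unfolding \<Phi>_def using M 1 by (intro mult_left_mono add_mono) auto
      also have "\<dots> + D = g \<theta>"
        unfolding 2 g_def by (simp add: power2_eq_square algebra_simps add_divide_distrib diff_divide_distrib)
      finally have "\<Phi> ?z + D \<le> g \<theta>" by simp
      moreover have "u ?z \<le> ereal (\<Phi> ?z + D)" 
        using t0 by (intro uD ball2) (simp add: norm_mult)
      ultimately show ?thesis by (meson ereal_less_eq(3) order_trans)
    qed
    have hi: "(g has_integral 2 * pi * (M * (100 * sqrt t * (1 + 3 * \<delta> / 2 - 9 * \<delta>\<^sup>2 / 16) + (norm (w - k0))\<^sup>2 + t\<^sup>2 / 4) + D)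
        + pi * (- (M * 100 * sqrt t / 64))) {0..2 * pi}"
      unfolding g_def by (rule has_integral_trig_polynomial)
    have si: "set_integrable lborel {0..2 * pi} g"
      unfolding g_def by (intro borel_integrable_atLeastAtMost' continuous_intros)
    have "(LINT \<theta>:{0..2 * pi}|lborel. g \<theta>) / (2 * pi) =
        M * (100 * sqrt t * (1 + 3 * \<delta> / 2 - 9 * \<delta>\<^sup>2 / 16) + (norm (w - k0))\<^sup>2 + t\<^sup>2 / 4) + D - M * 100 * sqrt t / 128"
      unfolding set_borel_integral_eq_integral(2)[OF si] integral_unique[OF hi]
      by (simp add: field_simps)
    moreover have "ereal uw \<le> ereal ((LINT \<theta>:{0..2 * pi}|lborel. g \<theta>) / (2 * pi))"
      unfolding uw[symmetric]
      by (rule plurisubharmonic_on_circle_le[OF psh, of "t / 2" w "cvec b" g])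
        (use t0 ball2 U gle si in auto)
    ultimately have "0 \<le> M * (100 * sqrt t * (3 * \<delta> / 2 - 9 * \<delta>\<^sup>2 / 16) + t\<^sup>2 / 4 - 100 * sqrt t / 128)"
      by (simp add: D_def \<Phi>_def t_def[symmetric] algebra_simps)
    then have "0 \<le> 100 * sqrt t * (3 * \<delta> / 2 - 9 * \<delta>\<^sup>2 / 16) + t\<^sup>2 / 4 - 100 * sqrt t / 128"
      using M by (simp add: zero_le_mult_iff)
    moreover have "sqrt t * (3 * \<delta> / 2 - 9 * \<delta>\<^sup>2 / 16) \<le> sqrt t * (3 / 800)"
    proof (rule mult_left_mono)
      have "0 \<le> 9 * \<delta>\<^sup>2 / 16" by simp
      then show "3 * \<delta> / 2 - 9 * \<delta>\<^sup>2 / 16 \<le> 3 / 800" using \<delta> by linarith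
    qed (use t0 in simp)
    moreover have "t\<^sup>2 \<le> sqrt t"
    proof -
      have "t\<^sup>2 \<le> t" using t0 t1 by (simp add: power2_eq_square mult_left_le)
      also have "t \<le> sqrt t" using t0 t1 by (simp add: real_le_rsqrt power2_eq_square mult_left_le)
      finally show ?thesis .
    qed
    moreover have "sqrt t > 0" using t0 by simp
    ultimately show False by linarith
  qed
  then have "u w - ereal (\<Phi> w) \<le> 0" by (cases "u w") auto
  then have "u z - ereal (\<Phi> z) \<le> 0" using wmax[OF z] by (rule order_trans[rotated])
  then have "u z \<le> ereal (\<Phi> z)" by (cases "u z") auto
  also have "\<Phi> z \<le> M * (100 * sqrt (dist z k0) + (dist z k0)\<^sup>2)"
    unfolding \<Phi>_def using M infdist_le[OF k0S, of z] by (intro mult_left_mono add_mono) (auto simp: dist_norm)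
  finally show ?thesis by simp
qed

section \<open>Decay at the vertex of a nearly flat corner\<close>

text \<open>
  Since \<open>100 / 300 + 1 / 90000\<^sup>2 \<le> 1 / 2\<close>, the preceding bound gives \<open>u \<le> M / 2\<close> within distance
  \<open>1 / 90000\<close> of the interior point \<open>k0\<close> of the corner. The circle \<open>z + cis t *s cvec x0\<close> around a
  point \<open>z\<close> close to the vertex \<open>0\<close> spends a fixed proportion of its time there: the three sources of
  error, namely \<open>z\<close>, \<open>e x0\<close> and the angle \<open>t\<close>, may each contribute a third, \<open>1 / 270000\<close>.
\<close>

lemma plurisubharmonic_le_corner:
  fixes e :: "real ^ 'n \<Rightarrow> complex ^ 'n"
  assumes psh: "plurisubharmonic_on U u" and U: "cball 0 (norm x0 + 3) \<subseteq> U"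
    and lip: "(1 / 400)-lipschitz_on (cball x0 4) e"
    and x0: "1 \<le> norm x0" and ex0: "norm (e x0) \<le> 1 / 270000"
    and M: "M > 0" "\<And>z. z \<in> cball 0 (norm x0 + 3) \<Longrightarrow> u z \<le> ereal M"
    and S0: "\<And>x. x \<in> cball x0 4 \<Longrightarrow> cvec x + e x \<in> cball 0 (norm x0 + 3) \<Longrightarrow> u (cvec x + e x) \<le> 0"
    and z: "norm z \<le> 1 / 270000"
  shows "u z \<le> ereal (M * (1 - 1 / (1080000 * pi * norm x0)))"
proof -
  define k0 where "k0 = cvec x0 + e x0"
  define \<theta>0 where "\<theta>0 = 1 / (270000 * norm x0)"
  define N where "N = norm x0"
  have N: "1 \<le> N" using x0 by (simp add: N_def)
  have k0N: "norm k0 \<le> N + 1 / 270000"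
    using norm_triangle_ineq[of "cvec x0" "e x0"] ex0 by (simp add: k0_def N_def)
  have sub: "cball k0 2 \<subseteq> cball 0 (N + 3)"
  proof
    fix y assume "y \<in> cball k0 2"
    then have "norm (y - k0) \<le> 2" by (simp add: dist_norm norm_minus_commute)
    then show "y \<in> cball 0 (N + 3)" using norm_triangle_ineq[of "y - k0" k0] k0N by simp
  qed
  have half: "u y \<le> ereal (M / 2)" if y: "dist y k0 \<le> 1 / 90000" for y
  proof -
    have "u y \<le> ereal (M * (100 * sqrt (dist y k0) + (dist y k0)\<^sup>2))"
      proof (rule plurisubharmonic_le_near_flat[OF psh _ lip _ k0_def M(1)])
      show "cball k0 2 \<subseteq> U" using U sub by (auto simp: N_def)
      show "u v \<le> ereal M" if "v \<in> cball k0 2" for v using M(2) sub that unfolding N_def by blast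
      show "u (cvec x + e x) \<le> 0" if "x \<in> cball x0 4" "cvec x + e x \<in> cball k0 2" for x
        using S0 sub that unfolding N_def by blast
    qed (use y in \<open>auto simp: dist_commute\<close>)
    also have "M * (100 * sqrt (dist y k0) + (dist y k0)\<^sup>2) \<le> M * (1 / 2)"
    proof (intro mult_left_mono)
      have "sqrt (dist y k0) \<le> sqrt ((1 / 300)\<^sup>2)" using y by (intro real_sqrt_le_mono) (simp add: power2_eq_square)
      then have "sqrt (dist y k0) \<le> 1 / 300" by simp
      moreover have "(dist y k0)\<^sup>2 \<le> (1 / 90000)\<^sup>2" using y by (intro power_mono) auto
      ultimately show "100 * sqrt (dist y k0) + (dist y k0)\<^sup>2 \<le> 1 / 2" by (simp add: power2_eq_square)
    qed (use M in simp)
    finally show ?thesis by simp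
  qed
  define g where "g t = M - M / 2 * indicator {0..\<theta>0} t" for t :: real
  have \<theta>0: "0 < \<theta>0" "\<theta>0 \<le> 1" using N by (auto simp: \<theta>0_def N_def[symmetric] divide_le_eq)
  then have \<theta>0': "\<theta>0 \<le> 2 * pi" using pi_gt3 by linarith
  have eq: "indicator {0..2 * pi} t *\<^sub>R g t = M * indicator {0..2 * pi} t - M / 2 * indicator {0..\<theta>0} t" for t
    using \<theta>0' by (auto simp: g_def indicator_def)
  have ind: "integrable lborel (indicat_real {0..c})" for c :: real
    by (intro integrable_real_indicator) (auto simp: emeasure_lborel_Icc_eq)
  have si: "set_integrable lborel {0..2 * pi} g"
    unfolding set_integrable_def eq by (intro Bochner_Integration.integrable_diff integrable_mult_right ind)
  have "(LINT t:{0..2 * pi}|lborel. g t) = M * (2 * pi) - M / 2 * \<theta>0"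
    unfolding set_lebesgue_integral_def eq using \<theta>0 by (subst Bochner_Integration.integral_diff) (auto intro!: integrable_mult_right ind)
  then have val: "(LINT t:{0..2 * pi}|lborel. g t) / (2 * pi) = M * (1 - 1 / (1080000 * pi * norm x0))"
    using N by (simp add: \<theta>0_def N_def field_simps)
  have "u z \<le> ereal ((LINT t:{0..2 * pi}|lborel. g t) / (2 * pi))"
  proof (rule plurisubharmonic_on_circle_le[OF psh, of 1 z "cvec x0" g])
    have in_ball: "z + \<zeta> *s cvec x0 \<in> cball 0 (N + 3)" if "norm \<zeta> \<le> 1" for \<zeta>
    proof -
      have "norm \<zeta> * norm x0 \<le> 1 * norm x0" using that by (intro mult_right_mono) auto
      then show ?thesis
        using norm_triangle_ineq[of z "\<zeta> *s cvec x0"] z by (simp add: norm_vector_smult N_def)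
    qed
    then show "z + \<zeta> *s cvec x0 \<in> U" if "norm \<zeta> \<le> 1" for \<zeta>
      using U that by (auto simp: N_def)
    fix t :: real assume t: "t \<in> {0..2 * pi}"
    let ?z = "z + (of_real 1 * cis t) *s cvec x0"
    show "u ?z \<le> ereal (g t)"
    proof (cases "t \<le> \<theta>0")
      case True
      have diff: "?z - k0 = z + (cis t - 1) *s cvec x0 - e x0"
        by (simp add: k0_def vec_eq_iff algebra_simps)
      have "norm (?z - k0) \<le> norm z + norm ((cis t - 1) *s cvec x0) + norm (e x0)"
        unfolding diff
        using norm_triangle_ineq4[of "z + (cis t - 1) *s cvec x0" "e x0"]
          norm_triangle_ineq[of z "(cis t - 1) *s cvec x0"] by linarith
      also have "norm ((cis t - 1) *s cvec x0) \<le> \<theta>0 * N"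
      proof -
        have "norm (cis t - 1) \<le> \<bar>t\<bar>"
          using dist_exp_i_1[of t] abs_sin_x_le_abs_x[of "t / 2"] by (simp add: cis_conv_exp)
        then show ?thesis unfolding norm_vector_smult N_def norm_cvec using True t by (intro mult_right_mono) auto
      qed
      also have "\<theta>0 * N = 1 / 270000" using N by (auto simp: \<theta>0_def N_def)
      finally have "dist ?z k0 \<le> 1 / 90000" using z ex0 by (simp add: dist_norm)
      then show ?thesis using half True t by (simp add: g_def)
    next
      case False
      then have "g t = M" by (simp add: g_def)
      then show ?thesis using M(2) in_ball[of "of_real 1 * cis t"] by (simp add: N_def)
    qed
  qed (use si in auto)
  then show ?thesis by (simp add: val)
qed

text \<open>
  The factor by which the bound improves and the ratio of the two radii in the preceding lemma do
  not depend on the scale. Hence the improvement can be repeated on smaller and smaller copies of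
  the corner, and all functions \<open>u j\<close> are at most \<open>M' * q ^ k\<close> on a ball about \<open>p\<close> that depends on \<open>k\<close>
  but not on \<open>j\<close>.
\<close>

theorem usc_regularization_le_0_at_corner:
  fixes A B :: "complex ^ 'n ^ 'n" and x0 :: "real ^ 'n" and u :: "nat \<Rightarrow> complex ^ 'n \<Rightarrow> ereal"
  assumes AB: "A ** B = mat 1" and x0: "1 \<le> norm x0" and U: "open U" "p \<in> U"
    and R0: "R0 > 0"
    and flat: "\<And>R. 0 < R \<Longrightarrow> R \<le> R0 \<Longrightarrow> \<exists>e. (1 / 400)-lipschitz_on (cball x0 4) e \<and>
       norm (e x0) \<le> 1 / 270000 \<and> (\<forall>x\<in>cball x0 4. p + A *v (R *\<^sub>R (cvec x + e x)) \<in> K)"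
    and psh: "\<And>j. plurisubharmonic_on U (u j)"
    and M: "\<And>j x. x \<in> U \<Longrightarrow> u j x \<le> ereal M"
    and K: "\<And>j x. x \<in> K \<inter> U \<Longrightarrow> u j x \<le> 0"
  shows "usc_regularization (\<lambda>y. SUP j. u j y) p \<le> 0"
proof -
  define N where "N = norm x0 + 3"
  define s where "s = 1 / (270000 * N)"
  define q where "q = 1 - 1 / (1080000 * pi * norm x0)"
  have N: "4 \<le> N" using x0 by (simp add: N_def)
  have s: "0 < s" "s \<le> 1" using N by (auto simp: s_def divide_le_eq)
  have "1 * 1 \<le> pi * norm x0" using x0 pi_gt3 by (intro mult_mono) auto
  then have q: "0 < q" "q < 1" by (auto simp: q_def divide_less_eq)
  \<comment> \<open>The bound that is improved step by step has to be positive.\<close>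
  define M' where "M' = max M 1"
  have M'u: "u j x \<le> ereal M'" if "x \<in> U" for j x
    using M[OF that, of j] by (auto simp: M'_def intro: order_trans)
  have M'0: "M' > 0" by (simp add: M'_def)
  have lin: "(R *\<^sub>R A) *v z = A *v (R *\<^sub>R z)" for R :: real and z
    by (simp add: matrix_vector_mult_def vec_eq_iff scaleR_conv_of_real[where 'a = complex] mult_ac)
  obtain c where c: "c > 0" "\<And>z. norm (A *v z) \<le> norm z * c"
    using bounded_linear.pos_bounded[OF matrix_vector_mul_bounded_linear[of A]] by blast
  obtain c' where c': "c' > 0" "\<And>z. norm (B *v z) \<le> norm z * c'"
    using bounded_linear.pos_bounded[OF matrix_vector_mul_bounded_linear[of B]] by blast
  obtain d where d: "d > 0" "cball p d \<subseteq> U" using U open_contains_cball by blast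
  define R1 where "R1 = min R0 (d / (N * c))"
  have R1: "0 < R1" "R1 \<le> R0" using R0 d c N by (auto simp: R1_def)
  have inU: "p + (R *\<^sub>R A) *v z \<in> U" if R: "0 < R" "R \<le> R1" and z: "z \<in> cball 0 N" for R z
  proof -
    have "norm ((R *\<^sub>R A) *v z) \<le> norm (R *\<^sub>R z) * c" unfolding lin by (rule c)
    also have "norm (R *\<^sub>R z) * c \<le> (R1 * N) * c"
      using R z c by (intro mult_right_mono) (auto intro!: mult_mono)
    also have "R1 * N * c \<le> d / (N * c) * N * c" using N c by (intro mult_right_mono) (auto simp: R1_def)
    also have "\<dots> = d" using N c by simp
    finally show ?thesis using d by (auto simp: dist_norm subset_iff)
  qed
  have decay: "\<forall>z\<in>cball 0 N. u j (p + ((R1 * s ^ k) *\<^sub>R A) *v z) \<le> ereal (M' * q ^ k)" for j k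
  proof (induction k)
    case 0
    show ?case using M'u inU[of R1] R1 by auto
  next
    case (Suc k)
    define R where "R = R1 * s ^ k"
    have "s ^ k \<le> 1" using s by (intro power_le_one) auto
    then have R: "0 < R" "R \<le> R1" using R1 s by (auto simp: R_def mult_left_le)
    obtain e where e: "(1 / 400)-lipschitz_on (cball x0 4) e" "norm (e x0) \<le> 1 / 270000"
        "\<forall>x\<in>cball x0 4. p + A *v (R *\<^sub>R (cvec x + e x)) \<in> K"
      using flat[of R] R R1 by auto
    show ?case
    proof
      fix z assume z: "z \<in> cball (0 :: complex ^ 'n) N"
      have "u j (p + (R *\<^sub>R A) *v (s *\<^sub>R z)) \<le> ereal (M' * q ^ k * (1 - 1 / (1080000 * pi * norm x0)))"
      proof (rule plurisubharmonic_le_corner[OF plurisubharmonic_on_affine[OF psh, of p "R *\<^sub>R A" j] _ e(1) x0 e(2)])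
        show "cball 0 (norm x0 + 3) \<subseteq> {z. p + (R *\<^sub>R A) *v z \<in> U}"
          using inU[OF R] by (auto simp: N_def)
        show "0 < M' * q ^ k" using M'0 q by simp
        show "u j (p + (R *\<^sub>R A) *v y) \<le> ereal (M' * q ^ k)" if "y \<in> cball 0 (norm x0 + 3)" for y
          using Suc that unfolding R_def N_def by blast
        show "u j (p + (R *\<^sub>R A) *v (cvec x + e x)) \<le> 0"
          if "x \<in> cball x0 4" "cvec x + e x \<in> cball 0 (norm x0 + 3)" for x
          using inU[OF R, of "cvec x + e x"] that e(3) unfolding lin N_def by (intro K) auto
        have "s * norm z \<le> s * N" using z s by (intro mult_left_mono) auto
        also have "s * N = 1 / 270000" using N by (simp add: s_def)
        finally show "norm (s *\<^sub>R z) \<le> 1 / 270000" using s by simp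
      qed
      then show "u j (p + ((R1 * s ^ Suc k) *\<^sub>R A) *v z) \<le> ereal (M' * q ^ Suc k)"
        unfolding lin by (simp add: R_def q_def mult_ac)
    qed
  qed
  have ev: "\<forall>\<^sub>F y in nhds p. (SUP j. u j y) \<le> ereal (M' * q ^ k)" for k
  proof -
    define R where "R = R1 * s ^ k"
    have R: "0 < R" using R1 s by (simp add: R_def)
    have "\<forall>\<^sub>F y in nhds p. y \<in> ball p (R * N / c')"
      by (intro eventually_nhds_in_open) (use R N c' in auto)
    then show ?thesis
    proof eventually_elim
      case (elim y)
      define z where "z = (1 / R) *\<^sub>R (B *v (y - p))"
      have "norm z \<le> 1 / R * (norm (y - p) * c')"
        using c'(2)[of "y - p"] R by (simp add: z_def divide_right_mono)
      also have "\<dots> \<le> 1 / R * (R * N / c' * c')"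
        using elim c' R by (intro mult_left_mono mult_right_mono) (auto simp: dist_norm norm_minus_commute)
      also have "\<dots> = N" using R c' by simp
      finally have zN: "z \<in> cball 0 N" by simp
      have "(R *\<^sub>R A) *v z = A *v (B *v (y - p))" unfolding lin using R by (simp add: z_def)
      also have "\<dots> = y - p" by (simp add: matrix_vector_mul_assoc AB)
      finally have "p + (R *\<^sub>R A) *v z = y" by simp
      then have "u j y \<le> ereal (M' * q ^ k)" for j using decay[of j k] zN unfolding R_def by metis
      then show ?case by (intro SUP_least)
    qed
  qed
  have lim: "(\<lambda>k. ereal (M' * q ^ k)) \<longlonglongrightarrow> ereal (M' * 0)"
    using q by (intro tendsto_intros LIMSEQ_power_zero) auto
  have "usc_regularization (\<lambda>y. SUP j. u j y) p \<le> ereal (M' * q ^ k)" for k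
    unfolding usc_regularization_def by (rule Limsup_bounded[OF ev])
  then have "usc_regularization (\<lambda>y. SUP j. u j y) p \<le> ereal (M' * 0)"
    by (intro LIMSEQ_le_const[OF lim]) auto
  then show ?thesis by (simp add: zero_ereal_def)
qed

section \<open>Charts\<close>

lemma Ck_on_continuous_on: "Ck_on k S f \<Longrightarrow> continuous_on S f"
  by (cases k) (auto intro!: continuous_at_imp_continuous_on differentiable_imp_continuous_within)

lemma Ck_on_Suc_differentiable:
  "Ck_on (Suc k) S f \<Longrightarrow> x \<in> S \<Longrightarrow> (f has_derivative frechet_derivative f (at x)) (at x)"
  by (simp add: frechet_derivative_works)

lemma Ck_on_Suc_continuous_derivative:
  "Ck_on (Suc k) S f \<Longrightarrow> continuous_on S (\<lambda>x. frechet_derivative f (at x) v)"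
  by (auto intro: Ck_on_continuous_on)

lemma Ck_on_subset: "Ck_on k S f \<Longrightarrow> T \<subseteq> S \<Longrightarrow> Ck_on k T f"
  by (induction k arbitrary: f) (auto intro: continuous_on_subset)

lemma Ck_on_cong_open:
  assumes "open S" "Ck_on k S f" "\<And>x. x \<in> S \<Longrightarrow> f x = g x"
  shows "Ck_on k S g"
  using assms(2,3)
proof (induction k arbitrary: f g)
  case 0
  then show ?case using continuous_on_cong[of S S f g] by simp
next
  case (Suc k)
  have der: "(g has_derivative frechet_derivative f (at x)) (at x)" if "x \<in> S" for x
    using has_derivative_transform_within_open[OF Ck_on_Suc_differentiable[OF Suc.prems(1) that] assms(1) that] Suc.prems(2)
    by blast
  have eq: "frechet_derivative f (at x) v = frechet_derivative g (at x) v" if "x \<in> S" for x v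
    using frechet_derivative_at[OF der[OF that]] by simp
  have "Ck_on k S (\<lambda>x. frechet_derivative f (at x) v)" for v
    using Suc.prems(1) by simp
  then have "Ck_on k S (\<lambda>x. frechet_derivative g (at x) v)" for v
    by (rule Suc.IH) (rule eq)
  then show ?case using der by (auto simp: differentiable_def)
qed

lemma Ck_on_scale_translate:
  assumes "open S" "Ck_on k S f"
  shows "Ck_on k S (\<lambda>x. c *\<^sub>R (f x - a))"
  using assms(2)
proof (induction k arbitrary: f a)
  case 0
  then show ?case by (auto intro!: continuous_intros)
next
  case (Suc k)
  have der: "((\<lambda>x. c *\<^sub>R (f x - a)) has_derivative (\<lambda>v. c *\<^sub>R (frechet_derivative f (at x) v - 0))) (at x)"
    if "x \<in> S" for x
    using Ck_on_Suc_differentiable[OF Suc.prems that] by (auto intro!: derivative_eq_intros)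
  then have eq: "c *\<^sub>R (frechet_derivative f (at x) v - 0) = frechet_derivative (\<lambda>x. c *\<^sub>R (f x - a)) (at x) v" if "x \<in> S" for x v
    using that frechet_derivative_at by metis
  have "Ck_on k S (\<lambda>x. c *\<^sub>R (frechet_derivative f (at x) v - 0))" for v
    using Suc.prems by (intro Suc.IH) auto
  then have "Ck_on k S (\<lambda>x. frechet_derivative (\<lambda>x. c *\<^sub>R (f x - a)) (at x) v)" for v
    by (rule Ck_on_cong_open[OF assms(1)]) (rule eq)
  then show ?case using der by (auto simp: differentiable_def)
qed

lemma Ck_on_compose_affine:
  fixes f :: "'a::euclidean_space \<Rightarrow> 'b::euclidean_space"
  assumes "open S" "Ck_on k S f"
  shows "Ck_on k {x. a + c *\<^sub>R x \<in> S} (\<lambda>x. f (a + c *\<^sub>R x))"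
  using assms(2)
proof (induction k arbitrary: f)
  case 0
  then show ?case
    by (auto intro!: continuous_on_compose2[of S f] continuous_intros)
next
  case (Suc k)
  have op: "open {x. a + c *\<^sub>R x \<in> S}"
    using open_vimage[OF assms(1), of "\<lambda>x. a + c *\<^sub>R x"] by (simp add: vimage_def continuous_intros)
  have der: "((\<lambda>x. f (a + c *\<^sub>R x)) has_derivative (\<lambda>v. frechet_derivative f (at (a + c *\<^sub>R x)) (c *\<^sub>R v))) (at x)"
    if "a + c *\<^sub>R x \<in> S" for x
    by (rule has_derivative_compose[of "\<lambda>x. a + c *\<^sub>R x" _ _ _ f, OF _ Ck_on_Suc_differentiable[OF Suc.prems that]])
       (auto intro!: derivative_eq_intros)
  then have eq: "frechet_derivative f (at (a + c *\<^sub>R x)) (c *\<^sub>R v) = frechet_derivative (\<lambda>x. f (a + c *\<^sub>R x)) (at x) v"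
    if "a + c *\<^sub>R x \<in> S" for x v
    using that frechet_derivative_at by metis
  have "Ck_on k {x. a + c *\<^sub>R x \<in> S} (\<lambda>x. frechet_derivative f (at (a + c *\<^sub>R x)) (c *\<^sub>R v))" for v
    using Suc.prems by (intro Suc.IH[of "\<lambda>y. frechet_derivative f (at y) (c *\<^sub>R v)"]) auto
  then have "Ck_on k {x. a + c *\<^sub>R x \<in> S} (\<lambda>x. frechet_derivative (\<lambda>x. f (a + c *\<^sub>R x)) (at x) v)" for v
    by (rule Ck_on_cong_open[OF op]) (rule eq, simp)
  then show ?case using der by (auto simp: differentiable_def)
qed

text \<open>
  Continuity of the directional derivatives along a basis yields continuity of the derivative in
  the operator norm.
\<close>

lemma Ck_on_Suc_derivative_close:
  fixes f :: "'a::euclidean_space \<Rightarrow> 'b::euclidean_space"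
  assumes S: "open S" "Ck_on (Suc k) S f" "y0 \<in> S" and \<epsilon>: "\<epsilon> > 0"
  obtains \<delta> where "\<delta> > 0" "ball y0 \<delta> \<subseteq> S"
    "\<And>y v. y \<in> ball y0 \<delta> \<Longrightarrow>
      norm (frechet_derivative f (at y) v - frechet_derivative f (at y0) v) \<le> \<epsilon> * norm v"
proof -
  let ?D = "\<lambda>y. frechet_derivative f (at y)"
  have "isCont (\<lambda>y. ?D y b) y0" for b
    using Ck_on_Suc_continuous_derivative[OF S(2), of b] S continuous_on_eq_continuous_at by blast
  then have "((\<lambda>y. \<Sum>b\<in>Basis. norm (?D y b - ?D y0 b)) \<longlongrightarrow> (\<Sum>b\<in>(Basis :: 'a set). norm (?D y0 b - ?D y0 b))) (at y0)"
    by (intro tendsto_intros) (auto simp: isCont_def)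
  then have "\<forall>\<^sub>F y in at y0. (\<Sum>b\<in>Basis. norm (?D y b - ?D y0 b)) < \<epsilon>"
    using \<epsilon> by (intro order_tendstoD) auto
  then obtain \<delta>1 where \<delta>1: "\<delta>1 > 0" "\<And>y. y \<noteq> y0 \<Longrightarrow> dist y y0 < \<delta>1 \<Longrightarrow> (\<Sum>b\<in>Basis. norm (?D y b - ?D y0 b)) < \<epsilon>"
    unfolding eventually_at by auto
  obtain \<delta>2 where \<delta>2: "\<delta>2 > 0" "ball y0 \<delta>2 \<subseteq> S" using S open_contains_ball by blast
  show thesis
  proof
    show "min \<delta>1 \<delta>2 > 0" using \<delta>1 \<delta>2 by simp
    show "ball y0 (min \<delta>1 \<delta>2) \<subseteq> S" using \<delta>2 by auto
    fix y v assume y: "y \<in> ball y0 (min \<delta>1 \<delta>2)"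
    have sum: "(\<Sum>b\<in>Basis. norm (?D y b - ?D y0 b)) \<le> \<epsilon>"
      using \<delta>1(2)[of y] y \<epsilon> by (cases "y = y0") (auto simp: dist_commute less_imp_le)
    have "y \<in> S" using y \<delta>2 by auto
    then have "linear (?D y)" "linear (?D y0)"
      using S Ck_on_Suc_differentiable[OF S(2)] by (blast intro: has_derivative_linear)+
    then have lin: "linear (\<lambda>v. ?D y v - ?D y0 v)" by (rule linear_compose_sub)
    have "?D y v - ?D y0 v = (\<lambda>v. ?D y v - ?D y0 v) (\<Sum>b\<in>Basis. (v \<bullet> b) *\<^sub>R b)"
      by (simp add: euclidean_representation)
    also have "\<dots> = (\<Sum>b\<in>Basis. (v \<bullet> b) *\<^sub>R (?D y b - ?D y0 b))"
      using linear_sum[OF lin, of "\<lambda>b. (v \<bullet> b) *\<^sub>R b" Basis] linear_scale[OF lin] by simp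
    also have "norm \<dots> \<le> (\<Sum>b\<in>Basis. norm v * norm (?D y b - ?D y0 b))"
      by (intro sum_norm_le) (auto intro!: mult_right_mono simp: Basis_le_norm)
    also have "\<dots> = (\<Sum>b\<in>Basis. norm (?D y b - ?D y0 b)) * norm v"
      by (simp add: sum_distrib_left mult.commute)
    also have "\<dots> \<le> \<epsilon> * norm v" using sum by (intro mult_right_mono) auto
    finally show "norm (?D y v - ?D y0 v) \<le> \<epsilon> * norm v" .
  qed
qed

lemma Ck_on_Suc_linear_approximation:
  fixes f :: "'a::euclidean_space \<Rightarrow> 'b::euclidean_space"
  assumes S: "open S" "Ck_on (Suc k) S f" "y0 \<in> S" and \<epsilon>: "\<epsilon> > 0"
  obtains \<delta> where "\<delta> > 0" "ball y0 \<delta> \<subseteq> S"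
    "\<And>y y'. y \<in> ball y0 \<delta> \<Longrightarrow> y' \<in> ball y0 \<delta> \<Longrightarrow>
      norm (f y - f y' - frechet_derivative f (at y0) (y - y')) \<le> \<epsilon> * norm (y - y')"
proof -
  let ?D = "\<lambda>y. frechet_derivative f (at y)"
  obtain \<delta> where \<delta>: "\<delta> > 0" "ball y0 \<delta> \<subseteq> S"
    "\<And>y v. y \<in> ball y0 \<delta> \<Longrightarrow> norm (?D y v - ?D y0 v) \<le> \<epsilon> * norm v"
    using Ck_on_Suc_derivative_close[OF S \<epsilon>] by blast
  have lin: "linear (?D y0)" using Ck_on_Suc_differentiable[OF S(2,3)] by (rule has_derivative_linear)
  have "norm ((f y - ?D y0 y) - (f y' - ?D y0 y')) \<le> \<epsilon> * norm (y - y')"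
    if "y \<in> ball y0 \<delta>" "y' \<in> ball y0 \<delta>" for y y'
  proof (rule differentiable_bound[of "ball y0 \<delta>" "\<lambda>y. f y - ?D y0 y" "\<lambda>x v. ?D x v - ?D y0 v"])
    fix x assume x: "x \<in> ball y0 \<delta>"
    show "((\<lambda>y. f y - ?D y0 y) has_derivative (\<lambda>v. ?D x v - ?D y0 v)) (at x within ball y0 \<delta>)"
    proof (rule has_derivative_diff)
      show "(f has_derivative ?D x) (at x within ball y0 \<delta>)"
        using x \<delta>(2) by (blast intro: has_derivative_at_withinI[OF Ck_on_Suc_differentiable[OF S(2)]])
      show "(?D y0 has_derivative ?D y0) (at x within ball y0 \<delta>)"
        by (rule linear_imp_has_derivative[OF lin])
    qed
    show "onorm (\<lambda>v. ?D x v - ?D y0 v) \<le> \<epsilon>" using \<delta>(3)[OF x] by (intro onorm_bound) (use \<epsilon> in auto)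
  qed (use that in auto)
  then show thesis using that[OF \<delta>(1,2)] by (simp add: linear_diff[OF lin] algebra_simps)
qed

lemma C5_ball_chart_inverse:
  fixes \<Psi> :: "'a::euclidean_space \<Rightarrow> 'a"
  assumes chart: "C5_ball_chart p W \<Psi>" and f: "f = inv_into W \<Psi>"
  shows "open W" "p \<in> W" "Ck_on 5 W \<Psi>" "Ck_on 5 (ball 0 1) f" "bij_betw \<Psi> W (ball 0 1)"
    "\<And>w. w \<in> W \<Longrightarrow> f (\<Psi> w) = w" "\<And>w. w \<in> W \<Longrightarrow> \<Psi> w \<in> ball 0 1"
    "\<And>y. y \<in> ball 0 1 \<Longrightarrow> f y \<in> W" "\<And>y. y \<in> ball 0 1 \<Longrightarrow> \<Psi> (f y) = y"
proof -
  have *: "open W \<and> p \<in> W \<and> Ck_on 5 W \<Psi> \<and> Ck_on 5 (ball 0 1) f \<and> bij_betw \<Psi> W (ball 0 1)"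
    using chart by (auto simp: C5_ball_chart_def Ck_diffeomorphism_def f)
  then show "open W" "p \<in> W" "Ck_on 5 W \<Psi>" "Ck_on 5 (ball 0 1) f" "bij_betw \<Psi> W (ball 0 1)" by auto
  show "\<And>w. w \<in> W \<Longrightarrow> f (\<Psi> w) = w" "\<And>w. w \<in> W \<Longrightarrow> \<Psi> w \<in> ball 0 1"
    "\<And>y. y \<in> ball 0 1 \<Longrightarrow> f y \<in> W" "\<And>y. y \<in> ball 0 1 \<Longrightarrow> \<Psi> (f y) = y"
    using * bij_betw_inv_into_left[of \<Psi> W "ball 0 1"] bij_betw_inv_into_right[of \<Psi> W "ball 0 1"]
      bij_betw_apply[of \<Psi> W "ball 0 1"] bij_betw_apply[OF bij_betw_inv_into, of \<Psi> W "ball 0 1"]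
    by (auto simp: f)
qed

lemma C5_ball_chart_derivative_inverse:
  fixes \<Psi> :: "'a::euclidean_space \<Rightarrow> 'a"
  assumes chart: "C5_ball_chart p W \<Psi>" and f: "f = inv_into W \<Psi>" and y: "y \<in> ball 0 1"
  shows "frechet_derivative \<Psi> (at (f y)) (frechet_derivative f (at y) v) = v"
    and "frechet_derivative f (at y) (frechet_derivative \<Psi> (at (f y)) v) = v"
proof -
  note c = C5_ball_chart_inverse[OF chart f]
  have five: "(5 :: nat) = Suc 4" by simp
  have df: "(f has_derivative frechet_derivative f (at y)) (at y)"
    using Ck_on_Suc_differentiable[of 4] c(4) y five by metis
  have dg: "(\<Psi> has_derivative frechet_derivative \<Psi> (at (f y))) (at (f y))"
    using Ck_on_Suc_differentiable[of 4] c(3) c(8)[OF y] five by metis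
  have "((\<lambda>x. \<Psi> (f x)) has_derivative (\<lambda>v. frechet_derivative \<Psi> (at (f y)) (frechet_derivative f (at y) v))) (at y)"
    by (rule has_derivative_compose[OF df dg])
  moreover have "((\<lambda>x. \<Psi> (f x)) has_derivative (\<lambda>v. v)) (at y)"
    by (rule has_derivative_transform_within_open[OF has_derivative_ident _ y]) (use c in auto)
  ultimately show "frechet_derivative \<Psi> (at (f y)) (frechet_derivative f (at y) v) = v"
    by (metis has_derivative_unique)
  have "(f has_derivative frechet_derivative f (at y)) (at (\<Psi> (f y)))"
    using df c(9)[OF y] by simp
  from has_derivative_compose[OF dg this]
  have "((\<lambda>x. f (\<Psi> x)) has_derivative (\<lambda>v. frechet_derivative f (at y) (frechet_derivative \<Psi> (at (f y)) v))) (at (f y))" .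
  moreover have "((\<lambda>x. f (\<Psi> x)) has_derivative (\<lambda>v. v)) (at (f y))"
    by (rule has_derivative_transform_within_open[OF has_derivative_ident c(1) c(8)[OF y]]) (use c in auto)
  ultimately show "frechet_derivative f (at y) (frechet_derivative \<Psi> (at (f y)) v) = v"
    by (metis has_derivative_unique)
qed

text \<open>
  Magnifying a small ball in the image of a chart gives charts around all nearby points; these are
  the charts that exhibit regular points.
\<close>

lemma C5_ball_chart_rescale:
  fixes \<Psi> :: "'a::euclidean_space \<Rightarrow> 'a"
  assumes chart: "C5_ball_chart p W \<Psi>" and f: "f = inv_into W \<Psi>"
    and s: "s > 0" "ball y s \<subseteq> ball 0 1"
  shows "C5_ball_chart (f y) {w \<in> W. \<Psi> w \<in> ball y s} (\<lambda>w. (1 / s) *\<^sub>R (\<Psi> w - y))"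
proof -
  note c = C5_ball_chart_inverse[OF chart f]
  let ?W = "{w \<in> W. \<Psi> w \<in> ball y s}" and ?\<Psi> = "\<lambda>w. (1 / s) *\<^sub>R (\<Psi> w - y)"
  let ?f = "\<lambda>x. f (y + s *\<^sub>R x)"
  have op: "open ?W"
    using continuous_open_preimage[OF Ck_on_continuous_on[OF c(3)] c(1) open_ball[of y s]]
    by (simp add: vimage_def Int_def)
  have y: "y \<in> ball 0 1" using s centre_in_ball[of y s] by blast
  have in_ball: "y + s *\<^sub>R x \<in> ball y s" if "x \<in> ball 0 1" for x using that s by (simp add: dist_norm)
  have fW: "?f x \<in> ?W" "?\<Psi> (?f x) = x" if "x \<in> ball 0 1" for x
    using in_ball[OF that] s c(8,9)[of "y + s *\<^sub>R x"] by auto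
  have \<Psi>W: "?\<Psi> w \<in> ball 0 1" "?f (?\<Psi> w) = w" if "w \<in> ?W" for w
  proof -
    have "norm (\<Psi> w - y) < s" using that by (simp add: dist_norm norm_minus_commute)
    then show "?\<Psi> w \<in> ball 0 1" using s by (simp add: divide_less_eq)
    show "?f (?\<Psi> w) = w" using that s c(6)[of w] by simp
  qed
  have bij: "bij_betw ?\<Psi> ?W (ball 0 1)"
    by (rule bij_betw_byWitness[where f' = ?f]) (use fW \<Psi>W in auto)
  have inv: "?f x = inv_into ?W ?\<Psi> x" if "x \<in> ball 0 1" for x
    using inv_into_f_f[OF bij_betw_imp_inj_on[OF bij] fW(1)[OF that]] fW(2)[OF that] by simp
  have "Ck_on 5 (ball 0 1) ?f"
    using Ck_on_subset[OF Ck_on_compose_affine[OF open_ball c(4), of y s], of "ball 0 1"] in_ball s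
    by blast
  then have "Ck_on 5 (ball 0 1) (inv_into ?W ?\<Psi>)"
    by (rule Ck_on_cong_open[OF open_ball]) (rule inv)
  moreover have "Ck_on 5 ?W ?\<Psi>"
    by (intro Ck_on_scale_translate op Ck_on_subset[OF c(3)]) auto
  moreover have "f y \<in> ?W" using c(8,9)[OF y] s by auto
  ultimately show ?thesis
    using op bij by (simp add: C5_ball_chart_def Ck_diffeomorphism_def)
qed

section \<open>Regular points and their tangent spaces\<close>

lemma regular_point_chart_image:
  fixes \<Psi> :: "'a::euclidean_space \<Rightarrow> 'a"
  assumes chart: "C5_ball_chart p W \<Psi>" and f: "f = inv_into W \<Psi>"
    and s: "s > 0" "ball y s \<subseteq> ball 0 1" and F: "subspace F" "dim F = m"
    and flat: "\<And>x. x \<in> ball y s \<Longrightarrow> f x \<in> K \<longleftrightarrow> x - y \<in> F"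
  shows "regular_point m K (f y)"
  unfolding regular_point_def
proof (intro conjI exI)
  note c = C5_ball_chart_inverse[OF chart f]
  let ?W = "{w \<in> W. \<Psi> w \<in> ball y s}" and ?\<Psi> = "\<lambda>w. (1 / s) *\<^sub>R (\<Psi> w - y)"
  show "f y \<in> K" using flat[of y] s subspace_0[OF F(1)] by simp
  show "C5_ball_chart (f y) ?W ?\<Psi>" by (rule C5_ball_chart_rescale[OF chart f s])
  show "?\<Psi> ` (K \<inter> ?W) = ball 0 1 \<inter> F"
  proof (intro equalityI subsetI)
    fix x assume "x \<in> ?\<Psi> ` (K \<inter> ?W)"
    then obtain w where w: "w \<in> K" "w \<in> W" "\<Psi> w \<in> ball y s" "x = ?\<Psi> w" by auto
    have "\<Psi> w - y \<in> F" using flat[OF w(3)] w c(6)[of w] by simp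
    then have "x \<in> F" using w(4) subspace_scale[OF F(1)] by simp
    moreover have "norm (\<Psi> w - y) < s" using w(3) by (simp add: dist_norm norm_minus_commute)
    then have "x \<in> ball 0 1" using s w(4) by (simp add: divide_less_eq)
    ultimately show "x \<in> ball 0 1 \<inter> F" by simp
  next
    fix x assume x: "x \<in> ball 0 1 \<inter> F"
    let ?y = "y + s *\<^sub>R x"
    have y: "?y \<in> ball y s" using x s by (simp add: dist_norm)
    then have "f ?y \<in> K" using flat[OF y] x subspace_scale[OF F(1)] by simp
    moreover have "f ?y \<in> W" "\<Psi> (f ?y) = ?y" using c(8,9)[of ?y] y s by auto
    moreover have "x = ?\<Psi> (f ?y)" using s by (simp add: \<open>\<Psi> (f ?y) = ?y\<close>)
    ultimately show "x \<in> ?\<Psi> ` (K \<inter> ?W)" using y by (intro image_eqI[where x = "f ?y"]) auto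
  qed
qed (use F in auto)

text \<open>
  In the chart a curve in \<open>K\<close> stays in the affine space \<open>y + F\<close>, so its velocity lies in \<open>F\<close>;
  conversely, straight segments of \<open>y + F\<close> give curves in \<open>K\<close>.
\<close>

lemma tangent_space_chart_image:
  fixes \<Psi> :: "'a::euclidean_space \<Rightarrow> 'a"
  assumes chart: "C5_ball_chart p W \<Psi>" and f: "f = inv_into W \<Psi>"
    and s: "s > 0" "ball y s \<subseteq> ball 0 1" and F: "subspace F"
    and flat: "\<And>x. x \<in> ball y s \<Longrightarrow> f x \<in> K \<longleftrightarrow> x - y \<in> F"
  shows "tangent_space K (f y) = frechet_derivative f (at y) ` F"
proof (intro equalityI subsetI)
  note c = C5_ball_chart_inverse[OF chart f]
  have five: "(5 :: nat) = Suc 4" by simp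
  have y: "y \<in> ball 0 1" using s centre_in_ball[of y s] by blast
  fix v assume "v \<in> tangent_space K (f y)"
  then obtain \<gamma> \<epsilon> where g: "\<epsilon> > 0" "\<gamma> ` {-\<epsilon><..<\<epsilon>} \<subseteq> K" "\<gamma> 0 = f y"
      "(\<gamma> has_vector_derivative v) (at 0)"
    by (auto simp: tangent_space_def)
  let ?D = "frechet_derivative \<Psi> (at (f y))"
  have D\<Psi>: "(\<Psi> has_derivative ?D) (at (f y))"
    using Ck_on_Suc_differentiable[of 4] c(3) c(8)[OF y] five by metis
  have "((\<lambda>t. \<Psi> (\<gamma> t)) has_derivative (\<lambda>t. ?D (t *\<^sub>R v))) (at 0)"
    by (rule has_derivative_compose) (use g D\<Psi> in \<open>auto simp: has_vector_derivative_def\<close>)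
  then have vd: "((\<lambda>t. \<Psi> (\<gamma> t)) has_vector_derivative ?D v) (at 0)"
    using linear_scale[OF has_derivative_linear[OF D\<Psi>]] by (simp add: has_vector_derivative_def)
  \<comment> \<open>In the chart the curve stays in \<open>y + F\<close>, and so do its difference quotients.\<close>
  have lim: "((\<lambda>t. (1 / t) *\<^sub>R (\<Psi> (\<gamma> t) - y)) \<longlongrightarrow> ?D v) (at 0)"
  proof -
    have "\<Psi> (\<gamma> 0) = y" using g(3) c(9)[OF y] by simp
    then have L: "((\<lambda>t. norm (\<Psi> (\<gamma> t) - y - t *\<^sub>R ?D v) / norm t) \<longlongrightarrow> 0) (at 0)"
      using vd unfolding has_vector_derivative_def has_derivative_at by simp
    have eq: "norm (\<Psi> (\<gamma> t) - y - t *\<^sub>R ?D v) / norm t = norm ((1 / t) *\<^sub>R (\<Psi> (\<gamma> t) - y) - ?D v)"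
      if "t \<noteq> 0" for t
    proof -
      have "(1 / t) *\<^sub>R (\<Psi> (\<gamma> t) - y) - ?D v = (1 / t) *\<^sub>R (\<Psi> (\<gamma> t) - y - t *\<^sub>R ?D v)"
        using that by (simp add: scaleR_diff_right)
      then show ?thesis by (simp only: norm_scaleR) simp
    qed
    have "((\<lambda>t. norm ((1 / t) *\<^sub>R (\<Psi> (\<gamma> t) - y) - ?D v)) \<longlongrightarrow> 0) (at 0)"
      by (rule Lim_transform_eventually[OF L]) (unfold eventually_at_filter, rule always_eventually, use eq in blast)
    then show ?thesis by (simp add: tendsto_norm_zero_iff LIM_zero_iff)
  qed
  have "isCont \<gamma> 0" using g(4) by (rule has_vector_derivative_continuous)
  then have "((\<gamma>) \<longlongrightarrow> f y) (at 0)" using g(3) by (simp add: isCont_def)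
  moreover have "open {w \<in> W. \<Psi> w \<in> ball y s}"
    using continuous_open_preimage[OF Ck_on_continuous_on[OF c(3)] c(1) open_ball[of y s]]
    by (simp add: vimage_def Int_def)
  moreover have "f y \<in> {w \<in> W. \<Psi> w \<in> ball y s}" using c(8,9)[OF y] s by auto
  ultimately have "\<forall>\<^sub>F t in at 0. \<gamma> t \<in> {w \<in> W. \<Psi> w \<in> ball y s}" by (rule topological_tendstoD)
  moreover have "\<forall>\<^sub>F t in at 0. t \<in> {-\<epsilon><..<\<epsilon>}"
    using g(1) by (intro eventually_at_in_open') auto
  ultimately have "\<forall>\<^sub>F t in at 0. (1 / t) *\<^sub>R (\<Psi> (\<gamma> t) - y) \<in> F"
  proof eventually_elim
    case (elim t)
    then have "\<gamma> t \<in> K" using g(2) by auto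
    then have "\<Psi> (\<gamma> t) - y \<in> F" using flat[of "\<Psi> (\<gamma> t)"] c(6)[of "\<gamma> t"] elim by auto
    then show ?case by (rule subspace_scale[OF F])
  qed
  then have "?D v \<in> F"
    by (rule Lim_in_closed_set[OF closed_subspace[OF F] _ _ lim]) simp
  then show "v \<in> frechet_derivative f (at y) ` F"
    using C5_ball_chart_derivative_inverse(2)[OF chart f y, of v] by (intro image_eqI[of _ _ "?D v"]) auto
next
  note c = C5_ball_chart_inverse[OF chart f]
  fix v assume "v \<in> frechet_derivative f (at y) ` F"
  then obtain w where w: "w \<in> F" "v = frechet_derivative f (at y) w" by auto
  have c5: "Ck_on (Suc 4) (ball 0 1) f" using c(4) by (simp add: numeral_eq_Suc)
  define \<epsilon> where "\<epsilon> = s / (norm w + 1)"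
  have \<epsilon>: "\<epsilon> > 0" using s by (simp add: \<epsilon>_def add_nonneg_pos)
  have in_ball: "y + t *\<^sub>R w \<in> ball y s" if "t \<in> {-\<epsilon><..<\<epsilon>}" for t
  proof -
    have "\<bar>t\<bar> * (norm w + 1) < \<epsilon> * (norm w + 1)"
      using that by (intro mult_strict_right_mono) (auto simp: add_nonneg_pos)
    also have "\<dots> = s" by (simp add: \<epsilon>_def add_nonneg_eq_0_iff)
    finally have "\<bar>t\<bar> * norm w < s" using that by (simp add: algebra_simps)
    then show ?thesis by (simp add: dist_norm)
  qed
  let ?\<gamma> = "\<lambda>t. f (y + t *\<^sub>R w)"
  have der: "(?\<gamma> has_vector_derivative frechet_derivative f (at (y + t *\<^sub>R w)) w) (at t)"
    if t: "t \<in> {-\<epsilon><..<\<epsilon>}" for t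
  proof -
    have Df: "(f has_derivative frechet_derivative f (at (y + t *\<^sub>R w))) (at (y + t *\<^sub>R w))"
      using in_ball[OF t] s by (intro Ck_on_Suc_differentiable[OF c5]) auto
    have "(?\<gamma> has_derivative (\<lambda>h. frechet_derivative f (at (y + t *\<^sub>R w)) (h *\<^sub>R w))) (at t)"
      by (rule has_derivative_compose[of "\<lambda>t. y + t *\<^sub>R w" _ _ _ f, OF _ Df]) (auto intro!: derivative_eq_intros)
    then show ?thesis
      using linear_scale[OF has_derivative_linear[OF Df]] by (simp add: has_vector_derivative_def)
  qed
  have "continuous_on {-\<epsilon><..<\<epsilon>} (\<lambda>t. frechet_derivative f (at (y + t *\<^sub>R w)) w)"
    by (rule continuous_on_compose2[OF Ck_on_Suc_continuous_derivative[OF c5, of w], of _ "\<lambda>t. y + t *\<^sub>R w"])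
       (use in_ball s in \<open>auto intro!: continuous_intros\<close>)
  then have "?\<gamma> C1_differentiable_on {-\<epsilon><..<\<epsilon>}"
    unfolding C1_differentiable_on_def using der
    by (intro exI[of _ "\<lambda>t. frechet_derivative f (at (y + t *\<^sub>R w)) w"] conjI ballI) auto
  moreover have "?\<gamma> ` {-\<epsilon><..<\<epsilon>} \<subseteq> K"
    using flat[OF in_ball] w subspace_scale[OF F] by auto
  moreover have "(?\<gamma> has_vector_derivative v) (at 0)" using der[of 0] \<epsilon> w by simp
  ultimately show "v \<in> tangent_space K (f y)"
    unfolding tangent_space_def using \<epsilon> by (intro CollectI exI[of _ ?\<gamma>] exI[of _ \<epsilon>]) auto
qed

text \<open>
  A set \<open>Q\<close> of the dimension of \<open>P\<close> that contains a relatively open piece of \<open>P\<close> has the same affine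
  hull as \<open>P\<close>. So each single \<open>Q\<close> can be avoided by an arbitrarily small move, and the sets already
  avoided are still avoided because they are closed.
\<close>

lemma rel_interior_avoids_closed_sets:
  fixes P :: "'a::euclidean_space set"
  assumes P: "convex P"
    and Q: "finite \<Q>" "\<And>Q. Q \<in> \<Q> \<Longrightarrow> closed Q" "\<And>Q. Q \<in> \<Q> \<Longrightarrow> aff_dim Q = aff_dim P"
      "\<And>Q. Q \<in> \<Q> \<Longrightarrow> affine hull Q \<noteq> affine hull P"
    and y: "y \<in> rel_interior P" and \<epsilon>: "\<epsilon> > 0"
  shows "\<exists>y'\<in>rel_interior P. dist y y' < \<epsilon> \<and> y' \<notin> \<Union>\<Q>"
  using Q y \<epsilon>
proof (induction \<Q> arbitrary: y \<epsilon> rule: finite_induct)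
  case empty
  then show ?case by (intro bexI[of _ y]) auto
next
  case (insert Q \<Q>)
  obtain y1 where y1: "y1 \<in> rel_interior P" "dist y y1 < \<epsilon> / 2" "y1 \<notin> \<Union>\<Q>"
    using insert.IH[of y "\<epsilon> / 2"] insert.prems by auto
  have "closed (\<Union>\<Q>)" using insert by (intro closed_Union) auto
  then have "open (- \<Union>\<Q>)" by (simp add: open_Compl)
  then obtain \<delta> where \<delta>: "\<delta> > 0" "ball y1 \<delta> \<subseteq> - \<Union>\<Q>"
    using y1(3) by (metis ComplI openE)
  define r where "r = min \<delta> (\<epsilon> / 2)"
  have r: "r > 0" using \<delta> insert.prems by (simp add: r_def)
  have "\<not> rel_interior P \<inter> ball y1 r \<subseteq> Q"
  proof
    assume sub: "rel_interior P \<inter> ball y1 r \<subseteq> Q"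
    have "y1 \<in> rel_interior P \<inter> ball y1 r" using y1 r by simp
    then have "affine hull (rel_interior P \<inter> ball y1 r) = affine hull rel_interior P"
      by (intro affine_hull_convex_Int_open convex_rel_interior P) auto
    then have "affine hull P \<subseteq> affine hull Q"
      using hull_mono[OF sub, of affine] rel_interior_same_affine_hull[OF P] by simp
    moreover have "affine hull P \<noteq> {}" using y1 rel_interior_subset by fastforce
    ultimately have "affine hull P = affine hull Q"
      using insert.prems(2)[of Q] by (intro affine_dim_equal) auto
    then show False using insert.prems(3)[of Q] by simp
  qed
  then obtain y' where y': "y' \<in> rel_interior P" "dist y1 y' < r" "y' \<notin> Q"
    unfolding subset_iff Int_iff mem_ball by blast
  have "dist y y' < \<epsilon>" using y1(2) y'(2) dist_triangle[of y y' y1] by (simp add: r_def)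
  moreover have "y' \<notin> \<Union>\<Q>" using \<delta>(2) y'(2) by (auto simp: r_def)
  ultimately show ?case using y' by auto
qed

text \<open>
  Take \<open>y\<close> in the relative interior of \<open>P\<close> and outside all polyhedra whose affine hull differs from
  that of \<open>P\<close>. Near \<open>y\<close> the remaining polyhedra lie in the affine hull of \<open>P\<close>, which \<open>P\<close> fills.
\<close>

lemma polyhedral_union_locally_affine:
  fixes \<P> :: "'a::euclidean_space set set"
  assumes fin: "finite \<P>" and poly: "\<And>P. P \<in> \<P> \<Longrightarrow> polyhedron P \<and> aff_dim P = int m"
    and P: "P \<in> \<P>" "y0 \<in> P" and \<epsilon>: "\<epsilon> > 0"
  obtains y s where "dist y0 y < \<epsilon>" "s > 0"
    "\<And>x. x \<in> ball y s \<Longrightarrow> x \<in> \<Union>\<P> \<longleftrightarrow> x - y \<in> span ((\<lambda>z. - y0 + z) ` P)"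
proof -
  define F where "F = span ((\<lambda>z. - y0 + z) ` P)"
  have cv: "convex P" and cl: "closed P"
    using poly[OF P(1)] by (auto simp: polyhedron_imp_convex polyhedron_imp_closed)
  have "y0 \<in> closure (rel_interior P)"
    using convex_closure_rel_interior[OF cv] P(2) cl by simp
  then obtain y1 where y1: "y1 \<in> rel_interior P" "dist y1 y0 < \<epsilon> / 2"
    using \<epsilon> by (metis closure_approachable half_gt_zero)
  define \<Q> where "\<Q> = {Q \<in> \<P>. affine hull Q \<noteq> affine hull P}"
  have Q: "finite \<Q>" "\<And>Q. Q \<in> \<Q> \<Longrightarrow> closed Q" "\<And>Q. Q \<in> \<Q> \<Longrightarrow> aff_dim Q = aff_dim P"
      "\<And>Q. Q \<in> \<Q> \<Longrightarrow> affine hull Q \<noteq> affine hull P"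
    using fin poly P by (auto simp: \<Q>_def polyhedron_imp_closed)
  obtain y where y: "y \<in> rel_interior P" "dist y1 y < \<epsilon> / 2" "y \<notin> \<Union>\<Q>"
    using rel_interior_avoids_closed_sets[OF cv Q y1(1), of "\<epsilon> / 2"] \<epsilon> by auto
  have "open (- \<Union>\<Q>)" using Q by (auto intro!: open_Compl closed_Union)
  then obtain s1 where s1: "s1 > 0" "ball y s1 \<subseteq> - \<Union>\<Q>" using y(3) by (metis ComplI openE)
  obtain s2 where s2: "s2 > 0" "ball y s2 \<inter> affine hull P \<subseteq> P" and yP: "y \<in> P"
    using y(1) by (auto simp: mem_rel_interior_ball)
  have aff: "x \<in> affine hull P \<longleftrightarrow> x - y \<in> F" for x
  proof -
    have hull: "affine hull P = (\<lambda>x. y0 + x) ` F"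
      unfolding F_def by (rule affine_hull_span_gen) (use P(2) in \<open>simp add: hull_inc\<close>)
    have mem: "x \<in> affine hull P \<longleftrightarrow> x - y0 \<in> F" for x
      unfolding hull by (auto intro: image_eqI[of _ _ "x - y0"])
    have "y - y0 \<in> F" using mem[of y] hull_inc[OF yP, of affine] by blast
    then have "x - y0 \<in> F \<longleftrightarrow> x - y \<in> F"
      using span_add[of "x - y" "(\<lambda>z. - y0 + z) ` P" "y - y0"] span_diff[of "x - y0" "(\<lambda>z. - y0 + z) ` P" "y - y0"]
      by (auto simp: F_def)
    then show ?thesis using mem by simp
  qed
  show thesis
  proof
    show "dist y0 y < \<epsilon>" using y(2) y1(2) dist_triangle[of y0 y y1] by (simp add: dist_commute)
    show "min s1 s2 > 0" using s1 s2 by simp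
    fix x assume x: "x \<in> ball y (min s1 s2)"
    have "x \<in> affine hull P" if "x \<in> Q" "Q \<in> \<P>" for Q
    proof -
      have "Q \<notin> \<Q>" using s1(2) x that by auto
      then have "affine hull Q = affine hull P" using that by (simp add: \<Q>_def)
      then show ?thesis using that hull_inc[of x Q affine] by simp
    qed
    moreover have "x \<in> P" if "x \<in> affine hull P" using s2(2) x that by auto
    ultimately have "x \<in> \<Union>\<P> \<longleftrightarrow> x \<in> affine hull P" using P(1) by blast
    then show "x \<in> \<Union>\<P> \<longleftrightarrow> x - y \<in> span ((\<lambda>z. - y0 + z) ` P)" using aff by (simp add: F_def)
  qed
qed

lemma closest_point_subspace_orthogonal:
  fixes E :: "'a::euclidean_space set"
  assumes E: "subspace E" and v: "v \<in> E"
  shows "inner (x - closest_point E x) v = 0"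
proof -
  let ?c = "closest_point E x"
  have cE: "?c \<in> E" using closest_point_in_set[OF closed_subspace[OF E]] v by auto
  have dot: "inner (x - ?c) (z - ?c) \<le> 0" if "z \<in> E" for z
    using closest_point_dot[OF subspace_imp_convex[OF E] closed_subspace[OF E] that] .
  have "inner (x - ?c) v \<le> 0" using dot[of "?c + v"] subspace_add[OF E cE v] by simp
  moreover have "inner (x - ?c) v \<ge> 0" using dot[of "?c - v"] subspace_diff[OF E cE v] by simp
  ultimately show ?thesis by simp
qed

lemma closest_point_subspace_norm_le:
  fixes E :: "'a::euclidean_space set"
  assumes E: "subspace E"
  shows "norm (closest_point E x) \<le> norm x" "norm (x - closest_point E x) \<le> norm x"
proof -
  let ?c = "closest_point E x"
  have cE: "?c \<in> E" using closest_point_in_set[OF closed_subspace[OF E]] subspace_0[OF E] by auto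
  have "inner (x - ?c) ?c = 0" by (rule closest_point_subspace_orthogonal[OF E cE])
  then have "(norm x)\<^sup>2 = (norm ?c)\<^sup>2 + (norm (x - ?c))\<^sup>2"
    by (simp add: power2_norm_eq_inner inner_diff_left inner_diff_right inner_commute)
  then have "(norm ?c)\<^sup>2 \<le> (norm x)\<^sup>2" "(norm (x - ?c))\<^sup>2 \<le> (norm x)\<^sup>2" by auto
  then show "norm ?c \<le> norm x" "norm (x - ?c) \<le> norm x"
    by (meson norm_ge_zero power2_le_imp_le)+
qed

text \<open>
  Let \<open>e\<close> and \<open>f\<close> be the projections of \<open>x\<close> to \<open>E\<close> and to \<open>B ` E\<close>. As \<open>x - e\<close> is orthogonal to
  \<open>E\<close> and \<open>x - f\<close> to \<open>B ` E\<close>, in \<open>norm (f - e)\<^sup>2 = (x - e) \<bullet> (f - e) - (x - f) \<bullet> (f - e)\<close> one may subtract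
  from \<open>f = B v\<close> in the first product the vector \<open>v\<close>, and from \<open>e\<close> in the second the vector \<open>B e\<close>;
  both differences are of order \<open>\<epsilon> norm x\<close>.
\<close>

lemma grassmannian_dist_image_le:
  fixes E :: "'a::euclidean_space set"
  assumes E: "subspace E" and B: "linear B" "\<And>v. norm (B v - v) \<le> \<epsilon> * norm v"
    and \<epsilon>: "0 \<le> \<epsilon>" "\<epsilon> \<le> 1 / 2"
  shows "0 \<le> grassmannian_dist (B ` E) E" "grassmannian_dist (B ` E) E \<le> sqrt (3 * \<epsilon>)"
proof -
  have F: "subspace (B ` E)" using linear_subspace_image[OF B(1) E] .
  have le: "norm (closest_point (B ` E) x - closest_point E x) \<le> sqrt (3 * \<epsilon>) * norm x" for x
  proof -
    let ?e = "closest_point E x" and ?f = "closest_point (B ` E) x"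
    have eE: "?e \<in> E" using closest_point_in_set[OF closed_subspace[OF E]] subspace_0[OF E] by auto
    have "?f \<in> B ` E" using closest_point_in_set[OF closed_subspace[OF F]] subspace_0[OF F] by auto
    then obtain v where v: "v \<in> E" "?f = B v" by auto
    have v2: "norm v \<le> 2 * norm x"
    proof -
      have "norm v \<le> norm (B v) + norm (B v - v)"
        using norm_triangle_ineq4[of "B v" "B v - v"] by simp
      also have "\<dots> \<le> norm x + 1 / 2 * norm v"
        using closest_point_subspace_norm_le(1)[OF F, of x] v(2) B(2)[of v] mult_right_mono[OF \<epsilon>(2), of "norm v"]
        by simp
      finally show ?thesis by simp
    qed
    have "(norm (?f - ?e))\<^sup>2 = inner (x - ?e) (?f - ?e) - inner (x - ?f) (?f - ?e)"
      by (simp add: power2_norm_eq_inner inner_diff_left)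
    also have "\<dots> = inner (x - ?e) (B v - v) + inner (x - ?f) (?e - B ?e)"
      using closest_point_subspace_orthogonal[OF E eE, of x] closest_point_subspace_orthogonal[OF E v(1), of x]
        closest_point_subspace_orthogonal[OF F, of "B ?e" x] closest_point_subspace_orthogonal[OF F, of ?f x] eE v
      by (simp add: inner_diff_right)
    also have "inner (x - ?e) (B v - v) \<le> norm x * (\<epsilon> * (2 * norm x))"
    proof -
      have "inner (x - ?e) (B v - v) \<le> norm (x - ?e) * norm (B v - v)" by (rule norm_cauchy_schwarz)
      also have "\<dots> \<le> norm x * (\<epsilon> * (2 * norm x))"
      proof (rule mult_mono)
        show "norm (B v - v) \<le> \<epsilon> * (2 * norm x)"
          using B(2)[of v] mult_left_mono[OF v2 \<epsilon>(1)] by linarith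
      qed (use closest_point_subspace_norm_le(2)[OF E, of x] in auto)
      finally show ?thesis .
    qed
    also have "inner (x - ?f) (?e - B ?e) \<le> norm x * (\<epsilon> * norm x)"
    proof -
      have "inner (x - ?f) (?e - B ?e) \<le> norm (x - ?f) * norm (?e - B ?e)" by (rule norm_cauchy_schwarz)
      also have "\<dots> \<le> norm x * (\<epsilon> * norm x)"
      proof (rule mult_mono)
        have "norm (?e - B ?e) \<le> \<epsilon> * norm ?e" using B(2)[of ?e] by (simp add: norm_minus_commute)
        also have "\<dots> \<le> \<epsilon> * norm x"
          using closest_point_subspace_norm_le(1)[OF E, of x] \<epsilon>(1) by (rule mult_left_mono)
        finally show "norm (?e - B ?e) \<le> \<epsilon> * norm x" .
      qed (use closest_point_subspace_norm_le(2)[OF F, of x] in auto)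
      finally show ?thesis .
    qed
    finally have "(norm (?f - ?e))\<^sup>2 \<le> (sqrt (3 * \<epsilon>) * norm x)\<^sup>2"
      using \<epsilon> by (simp add: power_mult_distrib algebra_simps power2_eq_square)
    then show ?thesis by (rule power2_le_imp_le) (use \<epsilon> in auto)
  qed
  show "grassmannian_dist (B ` E) E \<le> sqrt (3 * \<epsilon>)"
    unfolding grassmannian_dist_def by (rule onorm_bound) (use \<epsilon> le in auto)
  have "bdd_above (range (\<lambda>x. norm (closest_point (B ` E) x - closest_point E x) / norm x))"
  proof (rule bdd_aboveI2)
    fix x :: 'a
    show "norm (closest_point (B ` E) x - closest_point E x) / norm x \<le> sqrt (3 * \<epsilon>)"
      using le[of x] \<epsilon> by (cases "x = 0") (auto simp: divide_le_eq)
  qed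
  then have "norm (closest_point (B ` E) 0 - closest_point E 0) / norm (0 :: 'a) \<le> grassmannian_dist (B ` E) E"
    unfolding grassmannian_dist_def onorm_def by (rule cSUP_upper[OF UNIV_I])
  then show "0 \<le> grassmannian_dist (B ` E) E" by simp
qed

section \<open>A complex basis inside the tangent cone\<close>

lemma chart_image_in_iff:
  fixes \<Psi> :: "'a::euclidean_space \<Rightarrow> 'a"
  assumes chart: "C5_ball_chart p W \<Psi>" and f: "f = inv_into W \<Psi>"
    and K: "\<Psi> ` (K \<inter> W) = ball 0 1 \<inter> \<Union>\<P>" and x: "x \<in> ball 0 1"
  shows "f x \<in> K \<longleftrightarrow> x \<in> \<Union>\<P>"
proof
  note c = C5_ball_chart_inverse[OF chart f]
  show "x \<in> \<Union>\<P>" if "f x \<in> K"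
    using that K c(8,9)[OF x] by (metis IntD2 IntI imageI)
  show "f x \<in> K" if "x \<in> \<Union>\<P>"
  proof -
    have "x \<in> \<Psi> ` (K \<inter> W)" using K x that by blast
    then show ?thesis using c(6) by auto
  qed
qed

text \<open>
  Regular points accumulate at \<open>p\<close> inside the polyhedron \<open>P\<close>, and by continuity of the derivative
  their tangent spaces converge to the image \<open>E\<close> of the direction space of \<open>P\<close>. Genericity says
  \<open>E + \<i> E = UNIV\<close>. As \<open>E\<close> is the real span of the vectors in question, their complex span contains
  \<open>E + \<i> E\<close>.
\<close>

lemma CR_generic_chart_span:
  fixes K :: "(complex ^ 'n) set"
  assumes gen: "CR_generic m K" and p: "p \<in> K"
    and chart: "C5_ball_chart p W \<Psi>" and f: "f = inv_into W \<Psi>"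
    and fin: "finite \<P>" and poly: "\<And>P. P \<in> \<P> \<Longrightarrow> polyhedron P \<and> aff_dim P = int m"
    and K: "\<Psi> ` (K \<inter> W) = ball 0 1 \<inter> \<Union>\<P>" and P: "P \<in> \<P>" "\<Psi> p \<in> P"
  shows "vec.span (frechet_derivative f (at (\<Psi> p)) ` (\<lambda>z. - \<Psi> p + z) ` P) = UNIV"
proof -
  note c = C5_ball_chart_inverse[OF chart f]
  define y0 where "y0 = \<Psi> p"
  have y0: "y0 \<in> ball 0 1" and fy0: "f y0 = p" using c(6,7)[OF c(2)] by (auto simp: y0_def)
  have c5: "Ck_on (Suc 4) (ball 0 1) f" using c(4) by (simp add: numeral_eq_Suc)
  let ?Y = "(\<lambda>z. - y0 + z) ` P"
  define F where "F = span ?Y"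
  define D where "D y = frechet_derivative f (at y)" for y
  define C where "C = frechet_derivative \<Psi> (at p)"
  have linD: "linear (D y)" if "y \<in> ball 0 1" for y
    using has_derivative_linear[OF Ck_on_Suc_differentiable[OF c5 that]] by (simp add: D_def)
  have c5': "Ck_on (Suc 4) W \<Psi>" using c(3) by (simp add: numeral_eq_Suc)
  have "bounded_linear C"
    using has_derivative_bounded_linear[OF Ck_on_Suc_differentiable[OF c5' c(2)]] by (simp add: C_def)
  then obtain cC where cC: "cC > 0" "\<And>v. norm (C v) \<le> norm v * cC" and linC: "linear C"
    using bounded_linear.pos_bounded bounded_linear.linear by blast
  have CD: "C (D y0 v) = v" and DC: "D y0 (C v) = v" for v
    using C5_ball_chart_derivative_inverse[OF chart f y0, of v] by (simp_all add: C_def D_def fy0)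
  define E where "E = D y0 ` F"
  have F: "subspace F" by (simp add: F_def)
  have "y0 \<in> affine hull P" using P(2) by (simp add: y0_def hull_inc)
  then have "aff_dim P = int (dim ((+) (- y0) ` P))" by (rule aff_dim_eq_dim)
  then have dimF: "dim F = m" using poly[OF P(1)] by (simp add: F_def)
  have E: "subspace E" unfolding E_def by (rule linear_subspace_image[OF linD[OF y0] F])
  have "inj (D y0)" using CD by (metis injI)
  then have dimE: "dim E = m"
    unfolding E_def using dim_image_eq[OF linD[OF y0], of F] dimF by (metis inj_on_subset subset_UNIV)
  have "\<exists>y s. dist y0 y < 1 / real (Suc j) \<and> s > 0 \<and> ball y s \<subseteq> ball 0 1 \<and> (\<forall>x\<in>ball y s. f x \<in> K \<longleftrightarrow> x - y \<in> F)" for j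
  proof -
    have "0 < min (1 / real (Suc j)) (1 - norm y0)" using y0 by simp
    then obtain y s where ys: "dist y0 y < min (1 / real (Suc j)) (1 - norm y0)" "s > 0"
      "\<And>x. x \<in> ball y s \<Longrightarrow> x \<in> \<Union>\<P> \<longleftrightarrow> x - y \<in> F"
      using polyhedral_union_locally_affine[OF fin poly P(1), of y0] P(2) unfolding F_def y0_def by blast
    have "norm y < 1" using ys(1) norm_triangle_ineq2[of y y0] by (simp add: dist_norm norm_minus_commute)
    define s' where "s' = min s (1 - norm y)"
    have s': "s' > 0" using ys(2) \<open>norm y < 1\<close> by (simp add: s'_def)
    have sub: "ball y s' \<subseteq> ball 0 1"
    proof
      fix x assume "x \<in> ball y s'"
      then have "norm (x - y) < 1 - norm y" by (simp add: s'_def dist_norm norm_minus_commute)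
      then show "x \<in> ball 0 1" using norm_triangle_ineq2[of x y] by simp
    qed
    moreover have "\<forall>x\<in>ball y s'. f x \<in> K \<longleftrightarrow> x - y \<in> F"
    proof
      fix x assume x: "x \<in> ball y s'"
      then have "x \<in> ball y s" by (simp add: s'_def)
      then show "f x \<in> K \<longleftrightarrow> x - y \<in> F"
        using chart_image_in_iff[OF chart f K, of x] sub x ys(3) by blast
    qed
    ultimately show ?thesis using ys(1) s' by (intro exI[of _ y] exI[of _ s']) auto
  qed
  then obtain y s where y: "\<And>j. dist y0 (y j) < 1 / real (Suc j)" and s: "\<And>j. s j > 0" "\<And>j. ball (y j) (s j) \<subseteq> ball 0 1"
    and flat: "\<And>j x. x \<in> ball (y j) (s j) \<Longrightarrow> f x \<in> K \<longleftrightarrow> x - y j \<in> F"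
    by metis
  have yb: "y j \<in> ball 0 1" for j using s(2)[of j] s(1)[of j] centre_in_ball by blast
  have "(\<lambda>j. dist (y j) y0) \<longlonglongrightarrow> 0"
    by (rule tendsto_sandwich[OF _ _ tendsto_const LIMSEQ_inverse_real_of_nat])
      (use y in \<open>auto simp: dist_commute inverse_eq_divide less_imp_le\<close>)
  then have ylim: "y \<longlonglongrightarrow> y0" by (rule tendsto_dist_iff[THEN iffD2])
  have "isCont f y0" using Ck_on_continuous_on[OF c5] y0 continuous_on_eq_continuous_at open_ball by blast
  then have qlim: "(\<lambda>j. f (y j)) \<longlonglongrightarrow> p" using isCont_tendsto_compose[OF _ ylim, of f] fy0 by simp
  have reg: "regular_point m K (f (y j))" for j
    by (rule regular_point_chart_image[OF chart f s F dimF flat])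
  have tan: "tangent_space K (f (y j)) = (\<lambda>v. D (y j) (C v)) ` E" for j
    using tangent_space_chart_image[OF chart f s F flat, of j]
    unfolding E_def image_image CD D_def[symmetric] .
  have "(\<lambda>j. grassmannian_dist (tangent_space K (f (y j))) E) \<longlonglongrightarrow> 0"
  proof (rule LIMSEQ_I)
    fix \<epsilon> :: real assume \<epsilon>: "\<epsilon> > 0"
    define \<eta> where "\<eta> = min (1 / 2) (\<epsilon>\<^sup>2 / 6)"
    have \<eta>: "0 < \<eta>" "\<eta> \<le> 1 / 2" using \<epsilon> by (auto simp: \<eta>_def)
    have "3 * \<eta> < \<epsilon>\<^sup>2" using \<epsilon> by (auto simp: \<eta>_def min_def)
    then have sq: "sqrt (3 * \<eta>) < \<epsilon>" using \<epsilon> by (intro real_less_lsqrt) auto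
    have pos: "\<eta> / cC > 0" using \<eta> cC by simp
    obtain \<delta> where \<delta>: "\<delta> > 0" "ball y0 \<delta> \<subseteq> ball 0 1" "\<And>x v. x \<in> ball y0 \<delta> \<Longrightarrow> norm (D x v - D y0 v) \<le> \<eta> / cC * norm v"
      by (rule Ck_on_Suc_derivative_close[OF open_ball c5 y0 pos, folded D_def]) (rule that; blast)
    obtain N where N: "\<And>j. j \<ge> N \<Longrightarrow> dist (y j) y0 < \<delta>"
      using metric_LIMSEQ_D[OF ylim \<delta>(1)] by blast
    have "norm (grassmannian_dist (tangent_space K (f (y j))) E - 0) < \<epsilon>" if "j \<ge> N" for j
    proof -
      have "norm (D (y j) (C v) - v) \<le> \<eta> * norm v" for v
      proof -
        have "norm (D (y j) (C v) - v) \<le> \<eta> / cC * norm (C v)"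
          using \<delta>(3)[of "y j" "C v"] N[OF that] by (simp add: DC dist_commute)
        also have "\<dots> \<le> \<eta> / cC * (norm v * cC)"
          using cC \<eta> by (intro mult_left_mono) auto
        finally show ?thesis using cC by simp
      qed
      moreover have "linear (\<lambda>v. D (y j) (C v))"
        using linear_compose[OF linC linD[OF yb[of j]]] by (simp add: o_def)
      ultimately have "0 \<le> grassmannian_dist (tangent_space K (f (y j))) E"
          "grassmannian_dist (tangent_space K (f (y j))) E \<le> sqrt (3 * \<eta>)"
        using grassmannian_dist_image_le[OF E, of "\<lambda>v. D (y j) (C v)" \<eta>] \<eta> unfolding tan by auto
      then show ?thesis using sq by simp
    qed
    then show "\<exists>N. \<forall>j\<ge>N. norm (grassmannian_dist (tangent_space K (f (y j))) E - 0) < \<epsilon>" by blast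
  qed
  then have full: "{v + \<i> *s w | v w. v \<in> E \<and> w \<in> E} = UNIV"
    using gen[unfolded CR_generic_def, rule_format, OF p, of "\<lambda>j. f (y j)" E] reg qlim E dimE by blast
  have sub: "E \<subseteq> vec.span (D y0 ` ?Y)"
  proof -
    have "subspace (vec.span (D y0 ` ?Y))"
      by (auto simp: subspace_def scaleR_eq_of_real vec.span_zero intro: vec.span_add vec.span_scale)
    moreover have "D y0 ` ?Y \<subseteq> vec.span (D y0 ` ?Y)" by (rule vec.span_superset)
    ultimately have "span (D y0 ` ?Y) \<subseteq> vec.span (D y0 ` ?Y)" by (intro span_minimal)
    then show ?thesis by (simp add: E_def F_def linear_span_image[OF linD[OF y0], symmetric])
  qed
  have "z \<in> vec.span (D y0 ` ?Y)" for z
  proof -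
    have "z \<in> {v + \<i> *s w | v w. v \<in> E \<and> w \<in> E}" using full by blast
    then obtain v w where vw: "z = v + \<i> *s w" "v \<in> E" "w \<in> E" by blast
    have "\<i> *s w \<in> vec.span (D y0 ` ?Y)" using vw sub by (intro vec.span_scale) auto
    then show ?thesis unfolding vw(1) using vw sub by (intro vec.span_add) auto
  qed
  then show ?thesis by (auto simp: D_def y0_def)
qed

lemma invertible_matrix_from_spanning_set:
  fixes X :: "(complex ^ 'n) set"
  assumes "vec.span X = UNIV"
  shows "\<exists>(A :: complex ^ 'n ^ 'n) B b. (\<forall>i. b i \<in> X) \<and> A ** B = mat 1 \<and> B ** A = mat 1 \<and>
    (\<forall>z. A *v z = (\<Sum>i\<in>UNIV. z $ i *s b i))"
proof -
  obtain S where S: "S \<subseteq> X" "vec.independent S" "X \<subseteq> vec.span S" "card S = vec.dim X"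
    using vec.basis_exists by blast
  have spanS: "vec.span S = UNIV"
    using vec.span_minimal[OF S(3) vec.subspace_span] assms by auto
  have "vec.dim X = CARD('n)"
    using assms vec.dim_span[of X] vec_dim_card by metis
  then have "card S = card (UNIV :: 'n set)" using S by simp
  moreover have "finite S" using S(2) vec.finiteI_independent by blast
  ultimately obtain b where b: "bij_betw b (UNIV :: 'n set) S"
    using finite_same_card_bij[of "UNIV :: 'n set" S] by auto
  define A :: "complex ^ 'n ^ 'n" where "A = (\<chi> r c. b c $ r)"
  have "columns A = S"
    using b by (auto simp: columns_def column_def A_def bij_betw_def image_def)
  then obtain B where AB: "A ** B = mat 1"
    using matrix_right_invertible_span_columns[of A] spanS by auto
  show ?thesis
  proof (rule exI[of _ A], rule exI[of _ B], rule exI[of _ b], intro conjI allI)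
    show "b i \<in> X" for i using b S(1) by (auto simp: bij_betw_def)
    show "B ** A = mat 1" using AB matrix_left_right_inverse by blast
    show "A *v z = (\<Sum>i\<in>UNIV. z $ i *s b i)" for z
      by (simp add: matrix_vector_mult_def A_def vec_eq_iff mult.commute)
  qed fact
qed

lemma convex_combination_with_vertex:
  assumes P: "convex P" "y \<in> P" and v: "\<And>i. i \<in> I \<Longrightarrow> y + v i \<in> P" and I: "finite I"
    and t: "\<And>i. i \<in> I \<Longrightarrow> 0 \<le> t i" "sum t I \<le> 1"
  shows "y + (\<Sum>i\<in>I. t i *\<^sub>R v i) \<in> P"
proof (cases "sum t I = 0")
  case True
  then have "\<And>i. i \<in> I \<Longrightarrow> t i = 0" using t(1) I by (simp add: sum_nonneg_eq_0_iff)
  then show ?thesis using P by simp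
next
  case False
  define T where "T = sum t I"
  have T: "0 < T" "T \<le> 1" using False t sum_nonneg[of I t] by (auto simp: T_def less_le)
  have "(\<Sum>i\<in>I. (t i / T) *\<^sub>R (y + v i)) \<in> P"
    by (rule convex_sum[OF I P(1)]) (use T t v in \<open>auto simp: sum_divide_distrib[symmetric] T_def\<close>)
  also have "(\<Sum>i\<in>I. (t i / T) *\<^sub>R (y + v i)) = y + (1 / T) *\<^sub>R (\<Sum>i\<in>I. t i *\<^sub>R v i)"
    using T by (simp add: scaleR_add_right sum.distrib scaleR_sum_left[symmetric] sum_divide_distrib[symmetric] T_def[symmetric] scaleR_sum_right)
  finally have "(1 - T) *\<^sub>R y + T *\<^sub>R (y + (1 / T) *\<^sub>R (\<Sum>i\<in>I. t i *\<^sub>R v i)) \<in> P"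
    using T P by (intro convexD_alt) auto
  then show ?thesis using T by (simp add: algebra_simps)
qed

text \<open>
  By the preceding lemmas there are vectors \<open>v i\<close> with \<open>y0 + v i \<in> P\<close> whose images under the derivative
  of the inverse chart form a complex basis. The map \<open>x \<mapsto> f (y0 + \<Sum>i. x $ i *\<^sub>R v i)\<close> sends a small
  simplex into \<open>K\<close>. In the coordinates \<open>A\<close> of that basis it is \<open>x\<close> plus an error whose Lipschitz
  constant is small near the vertex because \<open>f\<close> is continuously differentiable. This is the corner
  required by the scaling argument.
\<close>

theorem usc_regularization_le_0_generic:
  fixes K :: "(complex ^ 'n) set" and u :: "nat \<Rightarrow> complex ^ 'n \<Rightarrow> ereal"
  assumes K: "C5_piecewise_smooth_submanifold m K" "CR_generic m K"
    and U: "open U" "p \<in> K" "p \<in> U"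
    and psh: "\<And>j. plurisubharmonic_on U (u j)"
    and M: "\<And>j x. x \<in> U \<Longrightarrow> u j x \<le> ereal M"
    and u0: "\<And>j x. x \<in> K \<inter> U \<Longrightarrow> u j x \<le> 0"
  shows "usc_regularization (\<lambda>y. SUP j. u j y) p \<le> 0"
proof -
  obtain W \<Psi> \<P> where chart: "C5_ball_chart p W \<Psi>" and fin: "finite \<P>"
    and poly_ball: "\<forall>P\<in>\<P>. polyhedron P \<and> aff_dim P = int m"
    and img: "\<Psi> ` (K \<inter> W) = ball 0 1 \<inter> \<Union>\<P>"
    using K(1) U(2) unfolding C5_piecewise_smooth_submanifold_def by meson
  have poly: "polyhedron P \<and> aff_dim P = int m" if "P \<in> \<P>" for P using poly_ball that by blast
  define f where "f = inv_into W \<Psi>"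
  note c = C5_ball_chart_inverse[OF chart f_def]
  define y0 where "y0 = \<Psi> p"
  have y0: "y0 \<in> ball 0 1" and fy0: "f y0 = p" using c(6,7)[OF c(2)] by (auto simp: y0_def)
  have c5: "Ck_on (Suc 4) (ball 0 1) f" using c(4) by (simp add: numeral_eq_Suc)
  have "y0 \<in> \<Union>\<P>" using img U(2) c(2) unfolding y0_def by blast
  then obtain P where P: "P \<in> \<P>" "y0 \<in> P" by blast
  have cv: "convex P" using poly[OF P(1)] polyhedron_imp_convex by blast
  define D where "D = frechet_derivative f (at y0)"
  have linD: "linear D"
    using has_derivative_linear[OF Ck_on_Suc_differentiable[OF c5 y0]] by (simp add: D_def)
  have span: "vec.span (D ` (\<lambda>z. - y0 + z) ` P) = UNIV"
    unfolding D_def y0_def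
    by (rule CR_generic_chart_span[OF K(2) U(2) chart f_def fin _ img]) (use poly P y0_def in auto)
  obtain A B :: "complex ^ 'n ^ 'n" and b where
    Ab: "(\<forall>i. b i \<in> D ` (\<lambda>z. - y0 + z) ` P) \<and> A ** B = mat 1 \<and> B ** A = mat 1 \<and>
      (\<forall>z. A *v z = (\<Sum>i\<in>UNIV. z $ i *s b i))"
    using invertible_matrix_from_spanning_set[OF span] by (elim exE) (rule that)
  have b: "\<And>i. b i \<in> D ` (\<lambda>z. - y0 + z) ` P" and AB: "A ** B = mat 1" "B ** A = mat 1"
    and A: "\<And>z. A *v z = (\<Sum>i\<in>UNIV. z $ i *s b i)"
    using Ab by auto
  have "\<forall>i. \<exists>v. y0 + v \<in> P \<and> b i = D v"
  proof
    fix i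
    obtain z where "z \<in> P" "b i = D (- y0 + z)" using b[of i] by auto
    then show "\<exists>v. y0 + v \<in> P \<and> b i = D v" by (intro exI[of _ "- y0 + z"]) auto
  qed
  then obtain v where v: "\<And>i. y0 + v i \<in> P" "\<And>i. b i = D (v i)" by metis
  define V where "V x = (\<Sum>i\<in>UNIV. x $ i *\<^sub>R v i)" for x :: "real ^ 'n"
  have linV: "linear V"
    by (rule linearI) (simp_all add: V_def scaleR_add_left sum.distrib scaleR_sum_right)
  have DV: "D (V x) = A *v cvec x" for x
  proof -
    have "D (V x) = (\<Sum>i\<in>UNIV. x $ i *\<^sub>R D (v i))"
      unfolding V_def linear_sum[OF linD] by (simp add: linear_scale[OF linD])
    then show ?thesis unfolding A v(2) by (simp add: cvec_def scaleR_eq_of_real)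
  qed
  have linA: "linear ((*v) A)" and linB: "linear ((*v) B)"
    by (auto intro: bounded_linear.linear matrix_vector_mul_bounded_linear)
  obtain cV where cV: "cV > 0" "\<And>x. norm (V x) \<le> norm x * cV"
    using bounded_linear.pos_bounded[OF linear_conv_bounded_linear[THEN iffD1, OF linV]] by blast
  obtain cB where cB: "cB > 0" "\<And>z. norm (B *v z) \<le> norm z * cB"
    using bounded_linear.pos_bounded[OF matrix_vector_mul_bounded_linear[of B]] by blast
  \<comment> \<open>The ball of radius 4 about \<open>x0\<close> lies in the positive orthant.\<close>
  define x0 :: "real ^ 'n" where "x0 = (\<chi> i. 4)"
  define N where "N = norm x0"
  have N: "4 \<le> N" using component_le_norm_cart[of x0 undefined] by (simp add: x0_def N_def)
  have box: "0 \<le> x $ i" "x $ i \<le> 8" if "x \<in> cball x0 4" for x i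
    using component_le_norm_cart[of "x - x0" i] that by (auto simp: x0_def dist_norm norm_minus_commute)
  \<comment> \<open>With this \<open>\<epsilon>\<close> the error has Lipschitz constant \<open>1 / (270000 * N)\<close>, which is below \<open>1 / 400\<close> and
    bounds the error at \<open>x0\<close> by \<open>1 / 270000\<close>.\<close>
  define \<epsilon> where "\<epsilon> = 1 / (270000 * N * cV * cB)"
  have \<epsilon>: "\<epsilon> > 0" using N cV cB by (simp add: \<epsilon>_def)
  have L: "cB * \<epsilon> * cV = 1 / (270000 * N)" using N cV cB by (simp add: \<epsilon>_def)
  obtain \<delta> where \<delta>: "\<delta> > 0" "ball y0 \<delta> \<subseteq> ball 0 1"
    "\<And>y y'. y \<in> ball y0 \<delta> \<Longrightarrow> y' \<in> ball y0 \<delta> \<Longrightarrow> norm (f y - f y' - D (y - y')) \<le> \<epsilon> * norm (y - y')"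
    by (rule Ck_on_Suc_linear_approximation[OF open_ball c5 y0 \<epsilon>, folded D_def]) (rule that; blast)
  define R0 where "R0 = min (1 / (8 * real CARD('n))) (\<delta> / (2 * (N + 4) * cV))"
  have R0: "R0 > 0" using \<delta> N cV by (simp add: R0_def)
  have flat: "\<exists>e. (1 / 400)-lipschitz_on (cball x0 4) e \<and> norm (e x0) \<le> 1 / 270000 \<and>
      (\<forall>x\<in>cball x0 4. p + A *v (R *\<^sub>R (cvec x + e x)) \<in> K)" if R: "0 < R" "R \<le> R0" for R
  proof -
    define e where "e x = B *v ((1 / R) *\<^sub>R (f (y0 + V (R *\<^sub>R x)) - p)) - cvec x" for x
    have near: "y0 + V (R *\<^sub>R x) \<in> ball y0 \<delta>" if "norm x \<le> N + 4" for x
    proof -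
      have "norm (V (R *\<^sub>R x)) \<le> norm (R *\<^sub>R x) * cV" by (rule cV)
      also have "\<dots> \<le> (R0 * (N + 4)) * cV"
        using R cV that by (intro mult_right_mono) (auto intro!: mult_mono)
      also have "\<dots> \<le> \<delta> / (2 * (N + 4) * cV) * (N + 4) * cV"
        using N cV by (intro mult_right_mono) (auto simp: R0_def)
      also have "\<dots> = \<delta> / 2"
      proof -
        have "d / (2 * a * c) * a * c = d / 2" if "a \<noteq> 0" "c \<noteq> 0" for a c d :: real
          using that by simp
        from this[of "N + 4" cV \<delta>] show ?thesis using N cV by linarith
      qed
      finally show ?thesis using \<delta>(1) by (simp add: dist_norm)
    qed
    have lip: "norm (e x - e x') \<le> 1 / (270000 * N) * norm (x - x')" if "norm x \<le> N + 4" "norm x' \<le> N + 4" for x x'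
    proof -
      let ?y = "y0 + V (R *\<^sub>R x)" and ?y' = "y0 + V (R *\<^sub>R x')"
      have y: "?y - ?y' = R *\<^sub>R V (x - x')"
        by (simp add: linear_scale[OF linV] linear_diff[OF linV] scaleR_diff_right)
      then have Dy: "D (?y - ?y') = R *\<^sub>R (A *v cvec (x - x'))" by (simp add: linear_scale[OF linD] DV)
      have "e x - e x' = B *v ((1 / R) *\<^sub>R (f ?y - f ?y' - D (?y - ?y')))"
        unfolding e_def Dy
        by (simp add: cvec_diff linear_diff[OF linB] linear_scale[OF linB] linear_diff[OF linA] scaleR_diff_right
            matrix_vector_mul_assoc AB R(1)[THEN less_imp_neq, symmetric])
      also have "norm \<dots> \<le> norm ((1 / R) *\<^sub>R (f ?y - f ?y' - D (?y - ?y'))) * cB" by (rule cB)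
      also have "\<dots> \<le> (1 / R * (\<epsilon> * (R * (norm (x - x') * cV)))) * cB"
      proof (rule mult_right_mono)
        have "norm (f ?y - f ?y' - D (?y - ?y')) \<le> \<epsilon> * norm (?y - ?y')"
          by (rule \<delta>(3)) (use near that in auto)
        also have "norm (?y - ?y') = R * norm (V (x - x'))" unfolding y using R by simp
        also have "\<epsilon> * (R * norm (V (x - x'))) \<le> \<epsilon> * (R * (norm (x - x') * cV))"
          using cV(2)[of "x - x'"] R \<epsilon> by (intro mult_left_mono) auto
        finally show "norm ((1 / R) *\<^sub>R (f ?y - f ?y' - D (?y - ?y'))) \<le> 1 / R * (\<epsilon> * (R * (norm (x - x') * cV)))"
          using R by (simp add: pos_divide_le_eq mult_ac)
      qed (use cB in simp)
      also have "\<dots> = (cB * \<epsilon> * cV) * norm (x - x')" using R by simp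
      finally show ?thesis unfolding L .
    qed
    have small: "norm x \<le> N + 4" if "x \<in> cball x0 4" for x
      using norm_triangle_ineq2[of x x0] that by (simp add: N_def dist_norm norm_minus_commute)
    have "(1 / 400)-lipschitz_on (cball x0 4) e"
    proof (rule lipschitz_onI)
      fix x x' assume "x \<in> cball x0 4" "x' \<in> cball x0 4"
      then have "norm (e x - e x') \<le> 1 / (270000 * N) * norm (x - x')" by (intro lip small)
      also have "\<dots> \<le> 1 / 400 * norm (x - x')"
        using N by (intro mult_right_mono divide_left_mono) auto
      finally show "dist (e x) (e x') \<le> 1 / 400 * dist x x'" by (simp add: dist_norm)
    qed simp
    moreover have "norm (e x0) \<le> 1 / 270000"
    proof -
      have "e 0 = 0" by (simp add: e_def fy0 linear_0[OF linV] linear_0[OF linB])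
      then show ?thesis using lip[of x0 0] N by (simp add: N_def[symmetric])
    qed
    moreover have "p + A *v (R *\<^sub>R (cvec x + e x)) \<in> K" if x: "x \<in> cball x0 4" for x
    proof -
      let ?y = "y0 + V (R *\<^sub>R x)"
      have "A *v (R *\<^sub>R (cvec x + e x)) = f ?y - p"
        using R by (simp add: e_def linear_scale[OF linA] linear_scale[OF linB] matrix_vector_mul_assoc AB)
      moreover have "?y \<in> ball 0 1" using near[OF small[OF x]] \<delta>(2) by blast
      moreover have "?y \<in> P"
      proof -
        have "(\<Sum>i\<in>UNIV. R * x $ i) \<le> (\<Sum>i\<in>(UNIV :: 'n set). R0 * 8)"
          using R box[OF x] by (intro sum_mono mult_mono) auto
        also have "\<dots> \<le> 1"
        proof -
          have "R0 * (8 * real CARD('n)) \<le> 1 / (8 * real CARD('n)) * (8 * real CARD('n))"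
            by (intro mult_right_mono) (auto simp: R0_def)
          then show ?thesis by (simp add: mult_ac)
        qed
        finally have "y0 + (\<Sum>i\<in>UNIV. (R * x $ i) *\<^sub>R v i) \<in> P"
          using box[OF x] R by (intro convex_combination_with_vertex cv P v) auto
        then show ?thesis by (simp add: V_def)
      qed
      ultimately show ?thesis using chart_image_in_iff[OF chart f_def img, of ?y] P(1) by auto
    qed
    ultimately show ?thesis by blast
  qed
  have "1 \<le> norm x0" using N by (simp add: N_def)
  then show ?thesis
    by (rule usc_regularization_le_0_at_corner[OF AB(1) _ U(1) U(3) R0 flat psh M u0])
qed

section \<open>Local regularity\<close>

theorem theorem1p2:
  fixes K :: "(complex ^ 'n) set" and m :: nat
  assumes "compact K"
    and "C5_piecewise_smooth_submanifold m K"
    and "CR_generic m K"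
  shows "locally_regular K"
  unfolding locally_regular_def
  \<comment> \<open>The preceding theorem holds in every open set, so any neighbourhood of \<open>z\<close> serves.\<close>
proof (intro ballI exI[of _ UNIV] conjI allI impI)
  fix u :: "nat \<Rightarrow> complex ^ 'n \<Rightarrow> ereal" and x
  assume u: "(\<forall>j. plurisubharmonic_on UNIV (u j)) \<and> (\<forall>x\<in>UNIV. incseq (\<lambda>j. u j x)) \<and>
      (\<exists>M::real. \<forall>j. \<forall>x\<in>UNIV. u j x \<le> ereal M) \<and> (\<forall>j. \<forall>x\<in>K \<inter> UNIV. u j x \<le> 0)"
    and x: "x \<in> K \<inter> UNIV"
  then obtain M where "\<forall>j x. u j x \<le> ereal M" by blast
  then show "usc_regularization (\<lambda>y. SUP j. u j y) x \<le> 0"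
    using u x by (intro usc_regularization_le_0_generic[OF assms(2,3) open_UNIV, of x u M]) auto
qed auto

end
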